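(* Let $\mathcal T\subset\mathbb{R}^3$ be a nondegenerate closed tetrahedron of volume $V$ with vertices $\boldsymbol P_1,\dots,\boldsymbol P_4$ and triangular faces $T^1,\dots,T^4$ with outward unit normals $\hat{\boldsymbol n}_1,\dots,\hat{\boldsymbol n}_4$. Consider a dipolar source with position $\boldsymbol r_0\in\mathbb{R}^3\setminus\mathcal T$ and moment $\boldsymbol q\in\mathbb{R}^3$, and let $f(\boldsymbol r)=\boldsymbol q\cdot\boldsymbol R/R^3=-\boldsymbol q\cdot\nabla R^{-1}$ with $\boldsymbol R=\boldsymbol r-\boldsymbol r_0$, $R=|\boldsymbol R|$. Let $\sigma^\infty>0$, let $\overline{\boldsymbol\sigma}^c$ be a $3\times3$ matrix (constant on $\mathcal T$), and let $\boldsymbol\varphi=[\varphi_1,\dots,\varphi_4]^T$ be the first order (affine) basis functions on $\mathcal T$ with $\varphi_i(\boldsymbol P_j)=\delta_{ij}$. Define the volume element source vector $\boldsymbol b^v\in\mathbb{R}^4$ by $$b^v_i=\frac{1}{4\pi\sigma^\infty}\int_{\mathcal T}\langle\overline{\boldsymbol\sigma}^c\nabla f(\boldsymbol r),\nabla\varphi_i(\boldsymbol r)\rangle\,d\boldsymbol r,\qquad i=1,\dots,4.$$ Then $$\boldsymbol b^v=\frac{\boldsymbol\Lambda^T\overline{\boldsymbol\sigma}^c}{24\pi V\sigma^\infty}\sum_{i=1}^4\hat{\boldsymbol n}_i\int_{T^i}f\,d\boldsymbol r,$$ and for each face $$\int_{T^i}f\,d\boldsymbol r=-\boldsymbol q\cdot\int_{T^i}\nabla\frac1R\,d\boldsymbol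 r=\boldsymbol q\cdot\Big(-\hat{\boldsymbol w}^i\,\mathrm{sgn}(w_0^i)\,\beta^i+\sum_{l=1}^3\hat{\boldsymbol m}_l^i\,f_{2l}^i\Big),$$ where the superscript $i$ on $\hat{\boldsymbol w},w_0,\beta,\hat{\boldsymbol m}_l,f_{2l}$ means that the quantities defined in the context are computed for the triangle $T^i$ and the source position $\boldsymbol r_0$.
   Context: $\boldsymbol\Lambda$ is the $3\times4$ matrix whose $i$-th column is $[b_i,c_i,d_i]^T$, where $a_i,b_i,c_i,d_i\in\mathbb{R}$ are the coefficients of the volume (barycentric) coordinates of $\mathcal T$: $\varphi_i(\boldsymbol r)=\xi_i=(a_i+b_ix_1+c_ix_2+d_ix_3)/(6V)$ for $\boldsymbol r=[x_1,x_2,x_3]^T$. Thus $\nabla\varphi_i=(6V)^{-1}[b_i,c_i,d_i]^T$. For a nondegenerate triangle $T$ with vertices $\boldsymbol p_1,\boldsymbol p_2,\boldsymbol p_3$ (indices cyclic, $\boldsymbol p_4=\boldsymbol p_1$, $\boldsymbol p_0=\boldsymbol p_3$) and a point $\boldsymbol r_0$, define: $\boldsymbol s_l=\boldsymbol p_{l-1}-\boldsymbol p_{l+1}$, $s_l=|\boldsymbol s_l|$, $\hat{\boldsymbol s}_l=\boldsymbol s_l/s_l$ ($l=1,2,3$); $\hat{\boldsymbol u}=\hat{\boldsymbol s}_3$, $\hat{\boldsymbol w}=(\hat{\boldsymbol s}_1\times\hat{\boldsymbol s}_2)/|\hat{\boldsymbol s}_1\times\hat{\boldsymbol s}_2|$,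 $\hat{\boldsymbol v}=\hat{\boldsymbol w}\times\hat{\boldsymbol u}$; $u_3=-\boldsymbol s_2\cdot\hat{\boldsymbol u}$, $v_3=-\boldsymbol s_2\cdot\hat{\boldsymbol v}$. Write $\boldsymbol r_0=\boldsymbol\rho-w_0\hat{\boldsymbol w}$ where $\boldsymbol\rho=\boldsymbol p_1+u_0\hat{\boldsymbol u}+v_0\hat{\boldsymbol v}$ is the orthogonal projection of $\boldsymbol r_0$ on the plane of $T$. Set $\hat{\boldsymbol m}_l=\hat{\boldsymbol s}_l\times\hat{\boldsymbol w}$, $t_1^0=[v_0(u_3-s_3)+v_3(s_3-u_0)]/s_1$, $t_2^0=(u_0v_3-v_0u_3)/s_2$, $t_3^0=v_0$, $s_1^-=-[(s_3-u_0)(s_3-u_3)+v_0v_3]/s_1$, $s_1^+=[(u_3-u_0)(u_3-s_3)+v_3(v_3-v_0)]/s_1$, $s_2^-=-[u_3(u_3-u_0)+v_3(v_3-v_0)]/s_2$, $s_2^+=(u_0u_3+v_0v_3)/s_2$, $s_3^-=-u_0$, $s_3^+=s_3-u_0$, $R_l^0=\sqrt{(t_l^0)^2+w_0^2}$, $R_l^\pm=\sqrt{(s_l^\pm)^2+(t_l^0)^2+w_0^2}$, $$f_{2l}=\ln\frac{R_l^++s_l^+}{R_l^-+s_l^-},\qquad \beta_l=\tan^{-1}\frac{t_l^0s_l^+}{(R_l^0)^2+|w_0|R_l^+}-\tan^{-1}\frac{t_l^0s_l^-}{(R_l^0)^2+|w_0|R_l^-},\qquad \beta=\beta_1+\beta_2+\beta_3,$$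 with $\tan^{-1}$ evaluated on its principal branch. $\mathrm{sgn}$ is the sign function. Integrals over faces are with respect to surface area; $\nabla$ is the gradient in $\mathbb{R}^3$ with respect to $\boldsymbol r$.
   Formalization: The last equality holds with −q in place of q before the bracket (the printed sign is wrong), and is asserted only when all three logarithms f_{2l} of the face are defined, i.e. r_0 is not on the line of an edge beyond its terminal vertex, where f_{2l} reads ln(0/0). *)

theory Defs
  imports "HOL-Analysis.Analysis"
begin

section \<open>Gradients and surface integrals over triangles\<close>

definition grad :: "(real^3 \<Rightarrow> real) \<Rightarrow> real^3 \<Rightarrow> real^3" where
  "grad g r = (THE D. GDERIV g r :> D)"

text \<open>
  A triangle is given by its vertices \<open>p 1, p 2, p 3\<close>, where \<open>p :: 3 \<Rightarrow> real^3\<close>. Arithmetic in the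
  index type \<open>3\<close> is modulo 3, so \<open>p (l - 1)\<close> and \<open>p (l + 1)\<close> are the cyclic neighbours of \<open>p l\<close>.

  The surface integral is taken through the affine parametrisation over the triangle
  \<open>{(x, y). 0 \<le> x, 0 \<le> y, x + y \<le> 1}\<close>, whose area element is the norm of the cross product.
\<close>

definition triangle_integral ::
    "(3 \<Rightarrow> real^3) \<Rightarrow> (real^3 \<Rightarrow> 'b) \<Rightarrow> 'b::{banach, second_countable_topology}" where
  "triangle_integral p g =
     norm (cross3 (p 2 - p 1) (p 3 - p 1)) *\<^sub>R
       (LINT z:{(x, y). 0 \<le> x \<and> 0 \<le> y \<and> x + y \<le> 1}|(lborel :: (real \<times> real) measure).
          g (p 1 + fst z *\<^sub>R (p 2 - p 1) + snd z *\<^sub>R (p 3 - p 1)))"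


section \<open>Tetrahedra\<close>

definition nondegenerate :: "(4 \<Rightarrow> real^3) \<Rightarrow> bool" where
  "nondegenerate P \<longleftrightarrow> inj P \<and> \<not> affine_dependent (range P)"

definition tetrahedron :: "(4 \<Rightarrow> real^3) \<Rightarrow> (real^3) set" where
  "tetrahedron P = convex hull (range P)"

text \<open>The face with index \<open>i\<close> is the one opposite the vertex \<open>P i\<close>.\<close>

definition outward_unit_normal :: "(4 \<Rightarrow> real^3) \<Rightarrow> 4 \<Rightarrow> real^3 \<Rightarrow> bool" where
  "outward_unit_normal P i n \<longleftrightarrow>
     norm n = 1 \<and>
     (\<forall>j k. j \<noteq> i \<longrightarrow> k \<noteq> i \<longrightarrow> n \<bullet> (P j - P k) = 0) \<and>
     (\<forall>j. j \<noteq> i \<longrightarrow> n \<bullet> (P i - P j) < 0)"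


section \<open>Dipolar source and volume element source vector\<close>

definition dipole_field :: "real^3 \<Rightarrow> real^3 \<Rightarrow> real^3 \<Rightarrow> real" where
  "dipole_field q r0 r = (q \<bullet> (r - r0)) / norm (r - r0) ^ 3"

definition volume_source_vector ::
    "real \<Rightarrow> real^3^3 \<Rightarrow> (real^3 \<Rightarrow> real) \<Rightarrow> (4 \<Rightarrow> real^3 \<Rightarrow> real) \<Rightarrow> (real^3) set \<Rightarrow> real^4" where
  "volume_source_vector \<sigma>inf \<sigma>c f \<phi> T =
     (\<chi> i. 1 / (4 * pi * \<sigma>inf) * (LINT r:T|lborel. (\<sigma>c *v grad f r) \<bullet> grad (\<phi> i) r))"


section \<open>Local quantities of a triangle \<open>p\<close> and a source position \<open>r0\<close>\<close>

definition edge :: "(3 \<Rightarrow> real^3) \<Rightarrow> 3 \<Rightarrow> real^3" where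
  "edge p l = p (l - 1) - p (l + 1)"

definition edge_len :: "(3 \<Rightarrow> real^3) \<Rightarrow> 3 \<Rightarrow> real" where
  "edge_len p l = norm (edge p l)"

definition s_hat :: "(3 \<Rightarrow> real^3) \<Rightarrow> 3 \<Rightarrow> real^3" where
  "s_hat p l = edge p l /\<^sub>R edge_len p l"

definition u_hat :: "(3 \<Rightarrow> real^3) \<Rightarrow> real^3" where
  "u_hat p = s_hat p 3"

definition w_hat :: "(3 \<Rightarrow> real^3) \<Rightarrow> real^3" where
  "w_hat p = cross3 (s_hat p 1) (s_hat p 2) /\<^sub>R norm (cross3 (s_hat p 1) (s_hat p 2))"

definition v_hat :: "(3 \<Rightarrow> real^3) \<Rightarrow> real^3" where
  "v_hat p = cross3 (w_hat p) (u_hat p)"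

definition m_hat :: "(3 \<Rightarrow> real^3) \<Rightarrow> 3 \<Rightarrow> real^3" where
  "m_hat p l = cross3 (s_hat p l) (w_hat p)"

definition u3 :: "(3 \<Rightarrow> real^3) \<Rightarrow> real" where
  "u3 p = - (edge p 2 \<bullet> u_hat p)"

definition v3 :: "(3 \<Rightarrow> real^3) \<Rightarrow> real" where
  "v3 p = - (edge p 2 \<bullet> v_hat p)"

text \<open>
  The coordinates of \<open>r0\<close> in the orthonormal frame of the triangle:
  \<open>r0 = p 1 + u0 *\<^sub>R u_hat + v0 *\<^sub>R v_hat - w0 *\<^sub>R w_hat\<close>. The minus sign in the last term
  explains the one in the definition of \<open>w0\<close>.
\<close>

definition u0 :: "(3 \<Rightarrow> real^3) \<Rightarrow> real^3 \<Rightarrow> real" where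
  "u0 p r0 = (r0 - p 1) \<bullet> u_hat p"

definition v0 :: "(3 \<Rightarrow> real^3) \<Rightarrow> real^3 \<Rightarrow> real" where
  "v0 p r0 = (r0 - p 1) \<bullet> v_hat p"

definition w0 :: "(3 \<Rightarrow> real^3) \<Rightarrow> real^3 \<Rightarrow> real" where
  "w0 p r0 = - ((r0 - p 1) \<bullet> w_hat p)"

definition t0 :: "(3 \<Rightarrow> real^3) \<Rightarrow> real^3 \<Rightarrow> 3 \<Rightarrow> real" where
  "t0 p r0 l =
     (if l = 1 then (v0 p r0 * (u3 p - edge_len p 3) + v3 p * (edge_len p 3 - u0 p r0)) / edge_len p 1
      else if l = 2 then (u0 p r0 * v3 p - v0 p r0 * u3 p) / edge_len p 2
      else v0 p r0)"

definition s_minus :: "(3 \<Rightarrow> real^3) \<Rightarrow> real^3 \<Rightarrow> 3 \<Rightarrow> real" where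
  "s_minus p r0 l =
     (if l = 1 then
        - ((edge_len p 3 - u0 p r0) * (edge_len p 3 - u3 p) + v0 p r0 * v3 p) / edge_len p 1
      else if l = 2 then
        - (u3 p * (u3 p - u0 p r0) + v3 p * (v3 p - v0 p r0)) / edge_len p 2
      else - u0 p r0)"

definition s_plus :: "(3 \<Rightarrow> real^3) \<Rightarrow> real^3 \<Rightarrow> 3 \<Rightarrow> real" where
  "s_plus p r0 l =
     (if l = 1 then
        ((u3 p - u0 p r0) * (u3 p - edge_len p 3) + v3 p * (v3 p - v0 p r0)) / edge_len p 1
      else if l = 2 then
        (u0 p r0 * u3 p + v0 p r0 * v3 p) / edge_len p 2
      else edge_len p 3 - u0 p r0)"

definition R_zero :: "(3 \<Rightarrow> real^3) \<Rightarrow> real^3 \<Rightarrow> 3 \<Rightarrow> real" where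
  "R_zero p r0 l = sqrt ((t0 p r0 l)\<^sup>2 + (w0 p r0)\<^sup>2)"

definition R_minus :: "(3 \<Rightarrow> real^3) \<Rightarrow> real^3 \<Rightarrow> 3 \<Rightarrow> real" where
  "R_minus p r0 l = sqrt ((s_minus p r0 l)\<^sup>2 + (t0 p r0 l)\<^sup>2 + (w0 p r0)\<^sup>2)"

definition R_plus :: "(3 \<Rightarrow> real^3) \<Rightarrow> real^3 \<Rightarrow> 3 \<Rightarrow> real" where
  "R_plus p r0 l = sqrt ((s_plus p r0 l)\<^sup>2 + (t0 p r0 l)\<^sup>2 + (w0 p r0)\<^sup>2)"

definition f2 :: "(3 \<Rightarrow> real^3) \<Rightarrow> real^3 \<Rightarrow> 3 \<Rightarrow> real" where
  "f2 p r0 l = ln ((R_plus p r0 l + s_plus p r0 l) / (R_minus p r0 l + s_minus p r0 l))"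

text \<open>
  If \<open>r0\<close> lies on the line through edge \<open>l\<close> beyond its terminal vertex
  (\<open>w0 = 0\<close>, \<open>t0 = 0\<close>, \<open>s_minus < 0\<close> and \<open>s_plus < 0\<close>), then the quotient in \<open>f2\<close> reads
  \<open>0 / 0\<close> and the logarithm is undefined.
\<close>

definition f2_defined :: "(3 \<Rightarrow> real^3) \<Rightarrow> real^3 \<Rightarrow> 3 \<Rightarrow> bool" where
  "f2_defined p r0 l \<longleftrightarrow>
     R_plus p r0 l + s_plus p r0 l > 0 \<and> R_minus p r0 l + s_minus p r0 l > 0"

text \<open>
  The quotients in \<open>\<beta>\<close> have denominator 0 only if \<open>w0 = 0\<close>. In that case \<open>\<beta>\<close> is
  multiplied by \<open>sgn w0 = 0\<close> wherever it is used.
\<close>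

definition beta_edge :: "(3 \<Rightarrow> real^3) \<Rightarrow> real^3 \<Rightarrow> 3 \<Rightarrow> real" where
  "beta_edge p r0 l =
     arctan (t0 p r0 l * s_plus p r0 l / ((R_zero p r0 l)\<^sup>2 + \<bar>w0 p r0\<bar> * R_plus p r0 l)) -
     arctan (t0 p r0 l * s_minus p r0 l / ((R_zero p r0 l)\<^sup>2 + \<bar>w0 p r0\<bar> * R_minus p r0 l))"

definition beta :: "(3 \<Rightarrow> real^3) \<Rightarrow> real^3 \<Rightarrow> real" where
  "beta p r0 = (\<Sum>l\<in>UNIV. beta_edge p r0 l)"

text \<open>
  Orientation of signs: since \<open>r0 = \<rho> - w0 *\<^sub>R w_hat\<close>, we have \<open>(r - r0) \<bullet> w_hat = w0\<close> on the
  triangle, and the integral of \<open>grad (\<lambda>r. 1 / norm (r - r0))\<close> over it is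
  \<open>- sgn w0 * beta *\<^sub>R w_hat + (\<Sum>l. f2 l *\<^sub>R m_hat l)\<close>. The integral of \<open>dipole_field q r0\<close> is
  the inner product of \<open>- q\<close> (not \<open>q\<close>) with this vector.
\<close>

end

theory Submission
  imports Defs
begin

text \<open>
  Since the coordinate functions are affine, \<open>grad (\<phi> i)\<close> is the constant vector \<open>(b $ i, c $ i, d $ i) / (6 V)\<close>, so the
  volume element source vector is a fixed linear image of the integral of \<open>grad f\<close> over the tetrahedron. The source
  lies outside, hence \<open>f\<close> is smooth there, and the theorem of Gauss (\<open>tetrahedron_gauss\<close>) turns this integral
  into the sum of the face integrals of \<open>f\<close> times the outward normals. On a face, \<open>f\<close> is the scalar product of \<open>- q\<close> and the
  gradient of \<open>1 / R\<close>, and only the integral of this gradient remains to be computed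
  (\<open>triangle_integral_grad_closed_form\<close>).

  Its tangential part is a boundary term: it is the sum over the edges of the conormal \<open>m_hat\<close> times the line integral
  of \<open>1 / R\<close>, and along an edge \<open>R\<close> is the square root of a quadratic polynomial in the arc length, so the line integral is a
  logarithm (\<open>f2_eq_integral\<close>). Its normal part is, up to sign, the integral of \<open>\<bar>w0\<bar> / R\<^sup>3\<close>, the solid angle of the
  triangle. This becomes a boundary term as well, because \<open>\<bar>w0\<bar> / R\<^sup>3\<close> is the surface divergence of the tangential part of
  \<open>(r - r0) / (R (R + \<bar>w0\<bar>))\<close> (\<open>tangential_divergence\<close>), a field without singularities when \<open>w0 \<noteq> 0\<close>; its flux through
  an edge is a difference of arctangents (\<open>beta_edge_eq_integral\<close>).

  All integral theorems rest on one lemma, \<open>integral_partial_derivative_below_graph\<close>. Applied in an affine parametrisation,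
  it says that the integral of the derivative of \<open>g\<close> in the direction of an edge is a difference of two integrals of \<open>g\<close>
  over the boundary: over the two other edges of a triangle, or over the two faces of a tetrahedron that do not contain
  the edge. No normals or traces occur; an equation between vectors follows by testing it against three
  linearly independent directions.
\<close>

section \<open>Vector algebra in three dimensions\<close>

abbreviation triple :: "real^3 \<Rightarrow> real^3 \<Rightarrow> real^3 \<Rightarrow> real" where
  "triple x y z \<equiv> x \<bullet> cross3 y z"

text \<open>
  Cramer's rule for \<open>x\<close> in the basis dual to \<open>a, b, c\<close>. It is the reason why an equation between
  vectors may be tested against three vectors with nonzero triple product, which is how both the
  theorem of Gauss and the closed form are proved below.
\<close>

lemma triple_expansion:
  "triple a b c *\<^sub>R x = (x \<bullet> a) *\<^sub>R cross3 b c + (x \<bullet> b) *\<^sub>R cross3 c a + (x \<bullet> c) *\<^sub>R cross3 a b"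
  by (simp add: forall_3 cross3_simps)

lemma eq_if_inner_eq_on_basis:
  assumes "triple a b c \<noteq> 0" "x \<bullet> a = y \<bullet> a" "x \<bullet> b = y \<bullet> b" "x \<bullet> c = y \<bullet> c"
  shows "x = y"
  using triple_expansion[of a b c x] triple_expansion[of a b c y] assms by (metis scaleR_left_imp_eq)

text \<open>
  Height times base area: \<open>norm (cross3 b c)\<close> is twice the area of a face, and \<open>\<bar>n \<bullet> a\<bar>\<close> is the
  distance of the opposite vertex from it. The unit normal \<open>n\<close> is parallel to \<open>cross3 b c\<close> because
  taking the cross product with \<open>n\<close> twice projects onto its orthogonal complement, up to sign.
\<close>

lemma inner_unit_normal_mult_norm_cross:
  fixes n :: "real^3"
  assumes n: "norm n = 1" "n \<bullet> b = 0" "n \<bullet> c = 0"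
  shows "\<bar>n \<bullet> a\<bar> * norm (cross3 b c) = \<bar>triple a b c\<bar>"
proof (cases "cross3 b c = 0")
  case False
  have "(n \<bullet> n) *\<^sub>R cross3 b c = (n \<bullet> cross3 b c) *\<^sub>R n"
  proof -
    have "cross3 n (cross3 b c) = (n \<bullet> c) *\<^sub>R b - (n \<bullet> b) *\<^sub>R c"
      by (simp add: forall_3 cross3_simps)
    then have "cross3 n (cross3 n (cross3 b c)) = 0"
      using n by simp
    moreover have "cross3 n (cross3 n v) = (n \<bullet> v) *\<^sub>R n - (n \<bullet> n) *\<^sub>R v" for v
      by (simp add: forall_3 cross3_simps)
    ultimately show ?thesis by simp
  qed
  then have eq: "cross3 b c = (n \<bullet> cross3 b c) *\<^sub>R n"
    using n by (simp add: dot_square_norm)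
  then have "norm (cross3 b c) = \<bar>n \<bullet> cross3 b c\<bar>"
    using n by (metis mult.right_neutral norm_scaleR)
  moreover have "triple a b c = (n \<bullet> cross3 b c) * (n \<bullet> a)"
    by (subst eq) (simp add: inner_commute)
  ultimately show ?thesis by (simp add: abs_mult)
qed simp

text \<open>
  The special case of the expansion by triple products in which the basis is \<open>s, cross3 s w, w\<close>,
  whose triple product is \<open>- 1\<close>.
\<close>

lemma orthonormal_expansion:
  fixes s w :: "real^3"
  assumes "norm s = 1" "norm w = 1" "s \<bullet> w = 0"
  shows "x = (x \<bullet> s) *\<^sub>R s + (x \<bullet> cross3 s w) *\<^sub>R cross3 s w + (x \<bullet> w) *\<^sub>R w"
proof -
  have lagrange: "cross3 (cross3 a b) c = (a \<bullet> c) *\<^sub>R b - (b \<bullet> c) *\<^sub>R a"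
    "cross3 a (cross3 b c) = (a \<bullet> c) *\<^sub>R b - (a \<bullet> b) *\<^sub>R c" for a b c :: "real^3"
    by (simp_all add: forall_3 cross3_simps)
  have unit: "s \<bullet> s = 1" "w \<bullet> w = 1" "w \<bullet> s = 0"
    using assms by (simp_all add: dot_square_norm inner_commute)
  have "cross3 (cross3 s w) w = - s" "cross3 w s = - cross3 s w" "cross3 s (cross3 s w) = - w"
    using unit assms(3) by (simp_all add: lagrange cross_skew[of w s])
  then have "- x = - ((x \<bullet> s) *\<^sub>R s + (x \<bullet> cross3 s w) *\<^sub>R cross3 s w + (x \<bullet> w) *\<^sub>R w)"
    using triple_expansion[of s "cross3 s w" w x] unit by simp
  then show ?thesis
    by (simp only: neg_equal_iff_equal)
qed

lemma orthonormal_norm: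
  fixes s w :: "real^3"
  assumes "norm s = 1" "norm w = 1" "s \<bullet> w = 0"
  shows "norm x = sqrt ((x \<bullet> s)\<^sup>2 + (x \<bullet> cross3 s w)\<^sup>2 + (x \<bullet> w)\<^sup>2)"
proof -
  have "x \<bullet> x = ((x \<bullet> s) *\<^sub>R s + (x \<bullet> cross3 s w) *\<^sub>R cross3 s w + (x \<bullet> w) *\<^sub>R w) \<bullet> x"
    by (rule arg_cong[where f = "\<lambda>y. y \<bullet> x", OF orthonormal_expansion[OF assms]])
  also have "\<dots> = (x \<bullet> s)\<^sup>2 + (x \<bullet> cross3 s w)\<^sup>2 + (x \<bullet> w)\<^sup>2"
    unfolding inner_add_left inner_scaleR_left power2_eq_square by (simp only: inner_commute[of _ x])
  finally show ?thesis
    by (simp only: norm_eq_sqrt_inner)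
qed

section \<open>Gradients of linear and radial functions\<close>

lemma GDERIV_imp_isCont: "GDERIV g r :> G \<Longrightarrow> isCont g r"
  unfolding gderiv_def by (rule has_derivative_continuous)

lemma affine_line_derivative:
  fixes g :: "'a::real_inner \<Rightarrow> real"
  assumes "GDERIV g (P + x *\<^sub>R v + Q) :> G"
  shows "((\<lambda>x. g (P + x *\<^sub>R v + Q)) has_real_derivative v \<bullet> G) (at x within S)"
proof -
  have "((\<lambda>x. P + x *\<^sub>R v + Q) has_derivative (\<lambda>h. h *\<^sub>R v)) (at x within S)"
    by (auto intro!: derivative_eq_intros)
  from has_derivative_compose[OF this assms[unfolded gderiv_def]]
  show ?thesis
    by (simp add: has_field_derivative_def mult.commute[of _ "v \<bullet> G"])
qed

lemma GDERIV_affine: "GDERIV (\<lambda>r. k + r \<bullet> v) r :> v"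
  unfolding gderiv_def by (auto intro!: derivative_eq_intros)

lemma GDERIV_radial:
  assumes "r \<noteq> r0" "(\<psi> has_real_derivative \<psi>') (at (norm (r - r0)))"
  shows "GDERIV (\<lambda>r. \<psi> (norm (r - r0))) r :> (\<psi>' / norm (r - r0)) *\<^sub>R (r - r0)"
proof -
  have "((\<lambda>r. r - r0) has_derivative (\<lambda>h. h)) (at r)"
    by (auto intro!: derivative_eq_intros)
  then have "((\<lambda>r. norm (r - r0)) has_derivative (\<lambda>h. h \<bullet> sgn (r - r0))) (at r)"
    using has_derivative_compose[OF _ has_derivative_norm, of "\<lambda>r. r - r0" "\<lambda>h. h" r UNIV] assms(1)
    by simp
  from has_derivative_compose[OF this assms(2)[unfolded has_field_derivative_def]]
  show ?thesis
    by (simp add: gderiv_def sgn_div_norm divide_inverse mult_ac)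
qed

text \<open>
  The dipole field and the components of the plane field whose divergence gives the solid angle
  are both of this form.
\<close>

lemma GDERIV_linear_times_radial:
  assumes "r \<noteq> r0" "(\<psi> has_real_derivative \<psi>') (at (norm (r - r0)))"
  shows "GDERIV (\<lambda>r. (c \<bullet> (r - r0)) * \<psi> (norm (r - r0))) r :>
    \<psi> (norm (r - r0)) *\<^sub>R c + ((c \<bullet> (r - r0)) * \<psi>' / norm (r - r0)) *\<^sub>R (r - r0)"
proof -
  have "GDERIV (\<lambda>r. c \<bullet> (r - r0)) r :> c"
    unfolding gderiv_def by (auto intro!: derivative_eq_intros simp: inner_commute)
  from GDERIV_mult[OF this GDERIV_radial[OF assms]] show ?thesis
    by (simp add: add.commute)
qed

lemma GDERIV_unique: "GDERIV g r :> D \<Longrightarrow> GDERIV g r :> E \<Longrightarrow> D = E"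
  unfolding gderiv_def using has_derivative_unique by (metis inner_commute vector_eq_rdot ext)

lemma grad_eqI: "GDERIV g r :> D \<Longrightarrow> grad g r = D"
  unfolding grad_def by (blast intro: GDERIV_unique)

lemma GDERIV_inverse_dist:
  assumes "r \<noteq> r0"
  shows "GDERIV (\<lambda>r. 1 / norm (r - r0)) r :> - (1 / norm (r - r0) ^ 3) *\<^sub>R (r - r0)"
proof -
  have "((\<lambda>s. 1 / s) has_real_derivative - 1 / (norm (r - r0))\<^sup>2) (at (norm (r - r0)))"
    using assms by (auto intro!: derivative_eq_intros simp: field_simps power2_eq_square)
  from GDERIV_radial[OF assms this] show ?thesis
    by (simp add: power2_eq_square power3_eq_cube)
qed

lemma GDERIV_dipole_field:
  assumes "r \<noteq> r0"
  shows "GDERIV (dipole_field q r0) r :>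
    (1 / norm (r - r0) ^ 3) *\<^sub>R q - (3 * (q \<bullet> (r - r0)) / norm (r - r0) ^ 5) *\<^sub>R (r - r0)"
proof -
  have "((\<lambda>s. 1 / s ^ 3) has_real_derivative - 3 / norm (r - r0) ^ 4) (at (norm (r - r0)))"
    using assms by (auto intro!: derivative_eq_intros simp: field_simps eval_nat_numeral)
  from GDERIV_linear_times_radial[OF assms this, of q] show ?thesis
    unfolding dipole_field_def by (simp add: eval_nat_numeral algebra_simps)
qed

section \<open>Integrals over triangles and segments through affine parametrisations\<close>

text \<open>
  Fubini's theorem followed by the fundamental theorem of calculus in the inner variable. Leaving the
  base space arbitrary lets the lemma serve twice: over an interval it treats a triangle, and
  over a triangle it treats a tetrahedron.
\<close>

lemma integral_partial_derivative_below_graph: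
  fixes D :: "'b::euclidean_space set" and c :: "'b \<Rightarrow> real" and g g' :: "real \<times> 'b \<Rightarrow> real"
  defines "S \<equiv> {(x, b). b \<in> D \<and> 0 \<le> x \<and> x \<le> c b}"
  assumes S: "compact S"
    and nonneg: "\<And>b. b \<in> D \<Longrightarrow> 0 \<le> c b"
    and der: "\<And>x b. b \<in> D \<Longrightarrow> 0 \<le> x \<Longrightarrow> x \<le> c b \<Longrightarrow>
      ((\<lambda>x. g (x, b)) has_real_derivative g' (x, b)) (at x within {0..c b})"
    and cont: "continuous_on S g'"
  shows "(LINT z:S|lborel. g' z) = (LINT b:D|lborel. g (c b, b) - g (0, b))"
proof -
  have int: "set_integrable lborel S g'"
    unfolding set_integrable_def by (rule borel_integrable_compact[OF S cont])
  have inner: "(LINT x|lborel. indicator S (x, b) *\<^sub>R g' (x, b)) = indicator D b *\<^sub>R (g (c b, b) - g (0, b))"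
    for b
  proof (cases "b \<in> D")
    case True
    have "(LINT x|lborel. indicator S (x, b) *\<^sub>R g' (x, b)) = (LINT x|lborel. indicator {0..c b} x *\<^sub>R g' (x, b))"
      using True by (intro Bochner_Integration.integral_cong) (auto simp: S_def indicator_def)
    also have "\<dots> = g (c b, b) - g (0, b)"
    proof (rule integral_FTC_atLeastAtMost)
      show "continuous_on {0..c b} (\<lambda>x. g' (x, b))"
        using True by (intro continuous_on_compose2[OF cont]) (auto intro!: continuous_intros simp: S_def)
    qed (use True nonneg der in \<open>auto simp: has_real_derivative_iff_has_vector_derivative[symmetric]\<close>)
    finally show ?thesis using True by simp
  qed (simp add: S_def)
  have "(LINT z:S|lborel. g' z)
      = (LINT z|(lborel \<Otimes>\<^sub>M lborel). indicator S z *\<^sub>R g' z)"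
    by (simp add: lborel_prod set_lebesgue_integral_def)
  also have "\<dots> = (LINT b|lborel. LINT x|lborel. indicator S (x, b) *\<^sub>R g' (x, b))"
    using lborel_pair.integral_snd[of "\<lambda>x b. indicator S (x, b) *\<^sub>R g' (x, b)"] int
    by (simp add: lborel_prod set_integrable_def case_prod_beta')
  also have "\<dots> = (LINT b:D|lborel. g (c b, b) - g (0, b))"
    using inner by (simp add: set_lebesgue_integral_def)
  finally show ?thesis .
qed

definition unit_triangle :: "(real \<times> real) set" where
  "unit_triangle = {(x, y). 0 \<le> x \<and> 0 \<le> y \<and> x + y \<le> 1}"

text \<open>
  The surface integral over the triangle \<open>A, B, C\<close> without its constant area factor. Keeping the factor
  apart makes the gradient theorems purely affine: they mention edges but no normals.
\<close>

definition triangle_pullback ::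
    "'a::real_vector \<Rightarrow> 'a \<Rightarrow> 'a \<Rightarrow> ('a \<Rightarrow> 'b) \<Rightarrow> 'b::{banach, second_countable_topology}" where
  "triangle_pullback A B C g =
     (LINT z:unit_triangle|lborel. g (A + fst z *\<^sub>R (B - A) + snd z *\<^sub>R (C - A)))"

definition segment_pullback ::
    "'a::real_vector \<Rightarrow> 'a \<Rightarrow> ('a \<Rightarrow> 'b) \<Rightarrow> 'b::{banach, second_countable_topology}" where
  "segment_pullback A B g = (LINT t:{0..1}|lborel. g (A + t *\<^sub>R (B - A)))"

lemma compact_unit_triangle: "compact unit_triangle"
proof -
  have eq: "unit_triangle = {z. 0 \<le> fst z} \<inter> {z. 0 \<le> snd z} \<inter> {z. fst z + snd z \<le> 1}"
    by (auto simp: unit_triangle_def)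
  have "closed unit_triangle"
    unfolding eq by (intro closed_Int closed_Collect_le continuous_intros)
  moreover have "unit_triangle \<subseteq> {0..1} \<times> {0..1}"
    by (auto simp: unit_triangle_def)
  ultimately show ?thesis
    by (metis bounded_Times bounded_closed_interval bounded_subset compact_eq_bounded_closed)
qed

lemma triangle_point_in_hull:
  fixes A B C :: "'a::real_vector"
  assumes "(x, y) \<in> unit_triangle"
  shows "A + x *\<^sub>R (B - A) + y *\<^sub>R (C - A) \<in> convex hull {A, B, C}"
proof -
  have "A + x *\<^sub>R (B - A) + y *\<^sub>R (C - A) = (1 - x - y) *\<^sub>R A + x *\<^sub>R B + y *\<^sub>R C"
    by (simp add: algebra_simps)
  then show ?thesis
    using assms unfolding convex_hull_3 unit_triangle_def
    by clarsimp (intro exI[of _ "1 - x - y"] exI[of _ x] exI[of _ y], simp)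
qed

lemma segment_point_in_hull:
  fixes A B :: "'a::real_vector"
  assumes "t \<in> {0..1}"
  shows "A + t *\<^sub>R (B - A) \<in> convex hull {A, B}"
proof -
  have "A + t *\<^sub>R (B - A) = (1 - t) *\<^sub>R A + t *\<^sub>R B"
    by (simp add: algebra_simps)
  then show ?thesis
    using assms unfolding convex_hull_2
    by clarsimp (intro exI[of _ "1 - t"] exI[of _ t], simp)
qed

lemma integrable_triangle_pullback:
  fixes g :: "'a::real_normed_vector \<Rightarrow> 'b::{banach, second_countable_topology}"
  assumes "continuous_on (convex hull {A, B, C}) g"
  shows "set_integrable lborel unit_triangle (\<lambda>z. g (A + fst z *\<^sub>R (B - A) + snd z *\<^sub>R (C - A)))"
  unfolding set_integrable_def
proof (rule borel_integrable_compact[OF compact_unit_triangle])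
  show "continuous_on unit_triangle (\<lambda>z. g (A + fst z *\<^sub>R (B - A) + snd z *\<^sub>R (C - A)))"
    by (rule continuous_on_compose2[OF assms])
       (auto intro!: continuous_intros triangle_point_in_hull)
qed

lemma integrable_segment_pullback:
  fixes g :: "'a::real_normed_vector \<Rightarrow> 'b::{banach, second_countable_topology}"
  assumes "continuous_on (convex hull {A, B}) g"
  shows "set_integrable lborel {0..1} (\<lambda>t. g (A + t *\<^sub>R (B - A)))"
  unfolding set_integrable_def
proof (rule borel_integrable_compact)
  show "continuous_on {0..1} (\<lambda>t. g (A + t *\<^sub>R (B - A)))"
    by (rule continuous_on_compose2[OF assms])
       (auto intro!: continuous_intros segment_point_in_hull)
qed auto

lemma triangle_pullback_swap_23:
  fixes g :: "'a::real_normed_vector \<Rightarrow> 'b::{banach, second_countable_topology}"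
  assumes "continuous_on (convex hull {A, B, C}) g"
  shows "triangle_pullback A B C g = triangle_pullback A C B g"
proof -
  let ?h = "\<lambda>z. indicator unit_triangle z *\<^sub>R g (A + fst z *\<^sub>R (B - A) + snd z *\<^sub>R (C - A))"
  have "(LINT (y, x)|(lborel \<Otimes>\<^sub>M lborel). ?h (x, y)) = (LINT z|(lborel \<Otimes>\<^sub>M lborel). ?h z)"
    using integrable_triangle_pullback[OF assms]
    by (intro lborel_pair.integral_product_swap)
       (auto simp: set_integrable_def lborel_prod dest: borel_measurable_integrable)
  moreover have "(\<lambda>(y, x). ?h (x, y)) =
      (\<lambda>z. indicator unit_triangle z *\<^sub>R g (A + fst z *\<^sub>R (C - A) + snd z *\<^sub>R (B - A)))"
    by (auto simp: unit_triangle_def indicator_def fun_eq_iff algebra_simps)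
  ultimately show ?thesis
    by (simp add: triangle_pullback_def set_lebesgue_integral_def lborel_prod)
qed

text \<open>
  For fixed \<open>y\<close> the reflection \<open>x \<mapsto> 1 - y - x\<close> of the unit triangle exchanges the two vertices.
\<close>

lemma triangle_pullback_swap_12:
  fixes g :: "'a::real_normed_vector \<Rightarrow> 'b::{banach, second_countable_topology}"
  assumes "continuous_on (convex hull {A, B, C}) g"
  shows "triangle_pullback A B C g = triangle_pullback B A C g"
proof -
  let ?h = "\<lambda>x y. indicator unit_triangle (x, y) *\<^sub>R g (A + x *\<^sub>R (B - A) + y *\<^sub>R (C - A))"
  let ?k = "\<lambda>x y. indicator unit_triangle (x, y) *\<^sub>R g (B + x *\<^sub>R (A - B) + y *\<^sub>R (C - B))"
  have "{B, A, C} = {A, B, C}" by auto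
  with assms have assms': "continuous_on (convex hull {B, A, C}) g" by simp
  have "?h (1 - y - x) y = ?k x y" for x y
    by (auto simp: unit_triangle_def indicator_def algebra_simps)
  then have eq: "(LINT x|lborel. ?h x y) = (LINT x|lborel. ?k x y)" for y
    using lborel_integral_real_affine[of "-1" "\<lambda>x. ?h x y" "1 - y"] by simp
  have "triangle_pullback A B C g = (LINT y|lborel. LINT x|lborel. ?h x y)"
    using lborel_pair.integral_snd[of ?h] integrable_triangle_pullback[OF assms]
    by (simp add: triangle_pullback_def set_lebesgue_integral_def set_integrable_def lborel_prod case_prod_beta')
  also have "\<dots> = (LINT y|lborel. LINT x|lborel. ?k x y)"
    by (simp only: eq)
  also have "\<dots> = triangle_pullback B A C g"
    using lborel_pair.integral_snd[of ?k] integrable_triangle_pullback[OF assms']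
    by (simp add: triangle_pullback_def set_lebesgue_integral_def set_integrable_def lborel_prod case_prod_beta')
  finally show ?thesis .
qed

lemma segment_pullback_commute: "segment_pullback A B g = segment_pullback B A g"
proof -
  let ?h = "\<lambda>t. indicator {0..1::real} t *\<^sub>R g (A + t *\<^sub>R (B - A))"
  have "?h (1 - t) = indicator {0..1} t *\<^sub>R g (B + t *\<^sub>R (A - B))" for t
    by (auto simp: indicator_def algebra_simps)
  then show ?thesis
    using lborel_integral_real_affine[of "-1" ?h 1]
    by (simp add: segment_pullback_def set_lebesgue_integral_def)
qed

lemma triangle_pullback_cong:
  assumes "\<And>z. z \<in> unit_triangle \<Longrightarrow>
    g (A + fst z *\<^sub>R (B - A) + snd z *\<^sub>R (C - A)) = h (A + fst z *\<^sub>R (B - A) + snd z *\<^sub>R (C - A))"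
  shows "triangle_pullback A B C g = triangle_pullback A B C h"
  unfolding triangle_pullback_def set_lebesgue_integral_def
  using assms by (intro Bochner_Integration.integral_cong) (auto simp: indicator_def)

lemma inner_triangle_pullback:
  fixes G :: "'a::real_normed_vector \<Rightarrow> 'b::euclidean_space"
  assumes "continuous_on (convex hull {A, B, C}) G"
  shows "y \<bullet> triangle_pullback A B C G = triangle_pullback A B C (\<lambda>r. y \<bullet> G r)"
  using integrable_triangle_pullback[OF assms]
    integral_inner_right[of y lborel "\<lambda>z. indicator unit_triangle z *\<^sub>R G (A + fst z *\<^sub>R (B - A) + snd z *\<^sub>R (C - A))"]
  by (simp add: triangle_pullback_def set_lebesgue_integral_def set_integrable_def)

text \<open>
  The vertices of a face come in any order, so the surface integral has to be independent of it. The two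
  transpositions treated above generate all six orders; they preserve the area factor too.
\<close>

lemma triangle_integral_eq_pullback:
  fixes g :: "real^3 \<Rightarrow> 'b::{banach, second_countable_topology}"
  assumes cont: "continuous_on (convex hull {A, B, C}) g"
    and vertices: "range p = {A, B, C}" and ne: "A \<noteq> B" "A \<noteq> C" "B \<noteq> C"
  shows "triangle_integral p g = norm (cross3 (B - A) (C - A)) *\<^sub>R triangle_pullback A B C g"
proof -
  let ?T = "\<lambda>X Y Z. norm (cross3 (Y - X) (Z - X)) *\<^sub>R triangle_pullback X Y Z g"
  have c: "norm (cross3 (Y - X) (Z - X)) = norm (cross3 (Z - X) (Y - X))"
    "norm (cross3 (Y - X) (Z - X)) = norm (cross3 (X - Y) (Z - Y))" for X Y Z :: "real^3"
  proof -
    show "norm (cross3 (Y - X) (Z - X)) = norm (cross3 (Z - X) (Y - X))"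
      by (metis cross_skew norm_minus_cancel)
    have "cross3 (Y - X) (Z - X) = - cross3 (X - Y) (Z - Y)"
      by (simp add: forall_3 cross3_simps)
    then show "norm (cross3 (Y - X) (Z - X)) = norm (cross3 (X - Y) (Z - Y))"
      by (simp only: norm_minus_cancel)
  qed
  have *: "?T X Y Z = ?T X Z Y" "?T X Y Z = ?T Y X Z" if "{X, Y, Z} = {A, B, C}" for X Y Z
    using that cont c[of Y X Z] triangle_pullback_swap_12[of X Y Z g] triangle_pullback_swap_23[of X Y Z g]
    by simp_all
  have p: "{p 1, p 2, p 3} = {A, B, C}"
    using vertices by (auto simp: UNIV_3)
  then have "(p 1 = A \<and> p 2 = B \<and> p 3 = C) \<or> (p 1 = A \<and> p 2 = C \<and> p 3 = B) \<or> (p 1 = B \<and> p 2 = A \<and> p 3 = C) \<or>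
     (p 1 = B \<and> p 2 = C \<and> p 3 = A) \<or> (p 1 = C \<and> p 2 = A \<and> p 3 = B) \<or> (p 1 = C \<and> p 2 = B \<and> p 3 = A)"
    using ne by (simp add: set_eq_iff) metis
  moreover have "{A, B, C} = {B, A, C}" "{A, B, C} = {B, C, A}" "{A, B, C} = {C, A, B}"
     "{A, B, C} = {C, B, A}" "{A, B, C} = {A, C, B}" by auto
  ultimately have "?T (p 1) (p 2) (p 3) = ?T A B C"
    using * by metis
  then show ?thesis
    by (simp add: triangle_integral_def triangle_pullback_def unit_triangle_def)
qed

section \<open>The gradient theorem on triangles and tetrahedra\<close>

text \<open>
  Moving in the direction \<open>B - A\<close>, every line enters the triangle through the edge \<open>A C\<close> and leaves it through
  the edge \<open>B C\<close>, which explains the two terms on the right. The derivative of \<open>g\<close> along this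
  direction is the first partial derivative in the parametrisation.
\<close>

lemma triangle_pullback_gradient:
  fixes g :: "'a::real_inner \<Rightarrow> real"
  assumes der: "\<And>r. r \<in> convex hull {A, B, C} \<Longrightarrow> GDERIV g r :> G r"
    and cont: "continuous_on (convex hull {A, B, C}) (\<lambda>r. (B - A) \<bullet> G r)"
  shows "triangle_pullback A B C (\<lambda>r. (B - A) \<bullet> G r) = segment_pullback B C g - segment_pullback A C g"
proof -
  let ?p = "\<lambda>z. A + fst z *\<^sub>R (B - A) + snd z *\<^sub>R (C - A)"
  have S: "unit_triangle = {(x, y). y \<in> {0..1} \<and> 0 \<le> x \<and> x \<le> 1 - y}"
    by (auto simp: unit_triangle_def)
  have gc: "continuous_on (convex hull {A, B, C}) g"
    using der by (intro continuous_at_imp_continuous_on) (auto intro: GDERIV_imp_isCont)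
  have "triangle_pullback A B C (\<lambda>r. (B - A) \<bullet> G r) = (LINT z:unit_triangle|lborel. (B - A) \<bullet> G (?p z))"
    by (simp add: triangle_pullback_def)
  also have "\<dots> = (LINT y:{0..1}|lborel. g (?p (1 - y, y)) - g (?p (0, y)))"
    unfolding S
  proof (rule integral_partial_derivative_below_graph)
    show "continuous_on {(x, y). y \<in> {0..1} \<and> 0 \<le> x \<and> x \<le> 1 - y} (\<lambda>z. (B - A) \<bullet> G (?p z))"
      unfolding S[symmetric]
      by (rule continuous_on_compose2[OF cont]) (auto intro!: continuous_intros triangle_point_in_hull)
    show "((\<lambda>x. g (?p (x, y))) has_real_derivative (B - A) \<bullet> G (?p (x, y))) (at x within {0..1 - y})"
      if "y \<in> {0..1}" "0 \<le> x" "x \<le> 1 - y" for x y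
    proof -
      have "GDERIV g (A + x *\<^sub>R (B - A) + y *\<^sub>R (C - A)) :> G (A + x *\<^sub>R (B - A) + y *\<^sub>R (C - A))"
        using that by (intro der triangle_point_in_hull) (auto simp: unit_triangle_def)
      from affine_line_derivative[OF this] show ?thesis by simp
    qed
    show "compact {(x :: real, y :: real). y \<in> {0..1} \<and> 0 \<le> x \<and> x \<le> 1 - y}"
      using compact_unit_triangle by (simp only: S)
  qed auto
  also have "\<dots> = (LINT y:{0..1}|lborel. g (B + y *\<^sub>R (C - B)) - g (A + y *\<^sub>R (C - A)))"
    by (simp add: algebra_simps)
  also have "\<dots> = segment_pullback B C g - segment_pullback A C g"
    unfolding segment_pullback_def
    by (intro set_integral_diff integrable_segment_pullback continuous_on_subset[OF gc] hull_mono) auto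
  finally show ?thesis .
qed

text \<open>
  Written as the region below a graph over the unit triangle, which is the form that the
  integration of a partial derivative needs.
\<close>

definition unit_tetrahedron :: "(real \<times> real \<times> real) set" where
  "unit_tetrahedron = {(x, b). b \<in> unit_triangle \<and> 0 \<le> x \<and> x \<le> 1 - fst b - snd b}"

lemma compact_unit_tetrahedron: "compact unit_tetrahedron"
proof -
  have eq: "unit_tetrahedron = (UNIV \<times> unit_triangle) \<inter> {z. 0 \<le> fst z} \<inter> {z. fst z \<le> 1 - fst (snd z) - snd (snd z)}"
    by (auto simp: unit_tetrahedron_def)
  have "closed unit_tetrahedron"
    unfolding eq
    by (intro closed_Int closed_Collect_le continuous_intros closed_Times closed_UNIV
        compact_imp_closed[OF compact_unit_triangle])
  moreover have "unit_tetrahedron \<subseteq> {0..1} \<times> unit_triangle"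
    by (auto simp: unit_tetrahedron_def unit_triangle_def)
  ultimately show ?thesis
    by (metis bounded_Times bounded_closed_interval bounded_subset compact_eq_bounded_closed
        compact_unit_triangle)
qed

lemma Basis_vec3: "(Basis :: (real^3) set) = {axis 1 1, axis 2 1, axis 3 1}"
  by (auto simp: Basis_vec_def UNIV_3)

lemma Basis_real3: "(Basis :: (real \<times> real \<times> real) set) = {(1, 0, 0), (0, 1, 0), (0, 0, 1)}"
  by (auto simp: Basis_prod_def zero_prod_def)

text \<open>
  Lebesgue measure is determined by its values on boxes. This carries the integral over \<open>real^3\<close>, where
  the linear change of variables takes place, to a product space, where Fubini's theorem applies.
\<close>

lemma lborel_vec3_eq_distr:
  "(lborel :: (real^3) measure) = distr (lborel :: (real \<times> real \<times> real) measure) borel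
     (\<lambda>z. fst z *\<^sub>R axis 1 1 + fst (snd z) *\<^sub>R axis 2 1 + snd (snd z) *\<^sub>R axis 3 1)" (is "_ = distr _ _ ?v")
proof (rule lborel_eqI)
  have "continuous_on UNIV ?v"
    by (intro continuous_intros)
  then have [measurable]: "?v \<in> borel_measurable borel"
    by (rule borel_measurable_continuous_onI)
  fix l u :: "real^3" assume le: "\<And>b. b \<in> Basis \<Longrightarrow> l \<bullet> b \<le> u \<bullet> b"
  have le': "l $ i \<le> u $ i" for i
    using le[of "axis i 1"] by (simp add: inner_axis axis_in_Basis_iff)
  have "?v -` box l u = box (l $ 1, l $ 2, l $ 3) (u $ 1, u $ 2, u $ 3)"
    by (auto simp: mem_box_cart forall_3 axis_def mem_box Basis_prod_def)
  then have "emeasure (distr lborel borel ?v) (box l u)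
      = emeasure lborel (box (l $ 1, l $ 2, l $ 3) (u $ 1, u $ 2, u $ 3))"
    by (simp add: emeasure_distr)
  also have "\<dots> = ennreal (\<Prod>b\<in>Basis. ((u $ 1, u $ 2, u $ 3) - (l $ 1, l $ 2, l $ 3)) \<bullet> b)"
    by (rule emeasure_lborel_box) (use le' in \<open>auto simp: Basis_real3\<close>)
  also have "(\<Prod>b\<in>Basis. ((u $ 1, u $ 2, u $ 3) - (l $ 1, l $ 2, l $ 3)) \<bullet> b)
      = (u $ 1 - l $ 1) * ((u $ 2 - l $ 2) * (u $ 3 - l $ 3))"
    by (simp add: Basis_real3)
  also have "\<dots> = (\<Prod>b\<in>Basis. (u - l) \<bullet> b)"
    by (simp add: Basis_vec3 axis_eq_axis inner_axis)
  finally show "emeasure (distr lborel borel ?v) (box l u) = (\<Prod>b\<in>Basis. (u - l) \<bullet> b)" .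
qed simp

lemma tetrahedron_integral_affine:
  fixes A B C D :: "real^3" and G :: "real^3 \<Rightarrow> real^3"
  assumes det: "triple (B - A) (C - A) (D - A) \<noteq> 0"
    and cont: "continuous_on (convex hull {A, B, C, D}) G"
  shows "(LINT r:convex hull {A, B, C, D}|lborel. G r) =
    \<bar>triple (B - A) (C - A) (D - A)\<bar> *\<^sub>R
      (LINT z:unit_tetrahedron|lborel.
         G (A + fst z *\<^sub>R (B - A) + fst (snd z) *\<^sub>R (C - A) + snd (snd z) *\<^sub>R (D - A)))"
proof -
  let ?v = "\<lambda>z. fst z *\<^sub>R axis 1 1 + fst (snd z) *\<^sub>R axis 2 1 + snd (snd z) *\<^sub>R axis 3 1 :: real^3"
  define M where "M r = r $ 1 *\<^sub>R (B - A) + r $ 2 *\<^sub>R (C - A) + r $ 3 *\<^sub>R (D - A)" for r :: "real^3"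
  define S where "S = {r :: real^3. 0 \<le> r $ 1 \<and> 0 \<le> r $ 2 \<and> 0 \<le> r $ 3 \<and> r $ 1 + r $ 2 + r $ 3 \<le> 1}"
  define J where "J = \<bar>triple (B - A) (C - A) (D - A)\<bar>"
  have Mv: "M (?v z) = fst z *\<^sub>R (B - A) + fst (snd z) *\<^sub>R (C - A) + snd (snd z) *\<^sub>R (D - A)" for z
    by (simp add: M_def axis_def)
  have lin: "linear M"
    by (auto simp: M_def scaleR_add_left scaleR_add_right intro!: linearI)
  have detM: "\<bar>det (matrix M)\<bar> = J"
    by (simp add: J_def det_3 matrix_def M_def axis_def cross3_def inner_vec_def sum_3 vector_def algebra_simps)
  have injM: "inj M"
    using det detM det_nz_iff_inj[OF lin] by (auto simp: J_def)
  have compS: "compact S"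
  proof -
    have "closed S"
      unfolding S_def by (intro closed_Collect_conj closed_Collect_le continuous_intros)
    moreover have "S \<subseteq> cbox 0 (\<chi> i. 1)"
      by (auto simp: S_def mem_box_cart forall_3)
    ultimately show ?thesis
      by (metis bounded_cbox bounded_subset compact_eq_bounded_closed)
  qed
  have image: "(\<lambda>r. A + M r) ` S = convex hull {A, B, C, D}"
  proof -
    have "S = convex hull {0, axis 1 1, axis 2 1, axis 3 1}"
      using std_simplex[where 'a = "real^3"]
      by (simp add: S_def Basis_vec3 axis_eq_axis inner_axis add.assoc conj_assoc)
    then have "M ` S = convex hull {0, B - A, C - A, D - A}"
      using convex_hull_linear_image[OF lin, of "{0, axis 1 1, axis 2 1, axis 3 1}"]
      by (simp add: M_def axis_def)
    then show ?thesis
      using convex_hull_translation[of A "{0, B - A, C - A, D - A}"]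
      by (simp add: image_image[symmetric, of "(+) A" M])
  qed
  have contS: "continuous_on S (\<lambda>r. G (A + M r))"
    by (rule continuous_on_compose2[OF cont])
       (auto simp: image[symmetric] M_def intro!: continuous_intros)
  have intS: "set_integrable lborel S (\<lambda>r. G (A + M r))"
    unfolding set_integrable_def by (rule borel_integrable_compact[OF compS contS])
  have intH: "set_integrable lborel (convex hull {A, B, C, D}) G"
    unfolding set_integrable_def by (rule borel_integrable_compact[OF _ cont])
      (auto intro: finite_imp_compact_convex_hull)
  have "(LINT r:convex hull {A, B, C, D}|lborel. G r) = integral (convex hull {A, B, C, D}) G"
    by (rule set_borel_integral_eq_integral[OF intH])
  also have "\<dots> = integral S (\<lambda>r. J *\<^sub>R G (A + M r))"
  proof -
    have "(\<lambda>r. G (A + M r)) absolutely_integrable_on S"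
      using intS unfolding set_integrable_def
      by (subst integrable_completion) (auto dest: borel_measurable_integrable)
    then have "(\<lambda>r. \<bar>det (matrix M)\<bar> *\<^sub>R G (A + M r)) absolutely_integrable_on S"
      by simp
    moreover have "((\<lambda>r. A + M r) has_derivative M) (at r within S)" for r
      using has_derivative_add[OF has_derivative_const linear_imp_has_derivative[OF lin], of A] by simp
    moreover have "inj_on (\<lambda>r. A + M r) S"
      using injM by (auto simp: inj_on_def)
    ultimately have "integral ((\<lambda>r. A + M r) ` S) G = integral S (\<lambda>r. \<bar>det (matrix M)\<bar> *\<^sub>R G (A + M r))"
      using has_absolute_integral_change_of_variables_compact[OF compS, of "\<lambda>r. A + M r" "\<lambda>_. M" G] by blast
    then show ?thesis
      by (simp only: image detM)
  qed
  also have "\<dots> = J *\<^sub>R (LINT r:S|lborel. G (A + M r))"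
    using set_borel_integral_eq_integral[OF intS] by simp
  also have "(LINT r:S|lborel. G (A + M r)) = (LINT z:unit_tetrahedron|lborel. G (A + M (?v z)))"
  proof -
    have "(LINT r:S|lborel. G (A + M r)) = (LINT z|lborel. indicator S (?v z) *\<^sub>R G (A + M (?v z)))"
    proof -
      have "(\<lambda>r. indicator S r *\<^sub>R G (A + M r)) \<in> borel_measurable borel"
        using borel_measurable_integrable[OF intS[unfolded set_integrable_def]] by simp
      moreover have "?v \<in> lborel \<rightarrow>\<^sub>M borel"
        by (auto intro!: borel_measurable_continuous_onI continuous_intros)
      ultimately show ?thesis
        unfolding set_lebesgue_integral_def
        using integral_distr[of ?v lborel borel "\<lambda>r. indicator S r *\<^sub>R G (A + M r)"]
        by (simp only: lborel_vec3_eq_distr[symmetric])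
    qed
    moreover have "indicator S (?v z) = (indicator unit_tetrahedron z :: real)" for z
      by (auto simp: S_def unit_tetrahedron_def unit_triangle_def indicator_def axis_def)
    ultimately show ?thesis
      by (simp add: set_lebesgue_integral_def)
  qed
  finally show ?thesis
    unfolding Mv by (simp only: J_def add.assoc)
qed

text \<open>
  The spatial analogue of the gradient theorem on a triangle: lines in the direction \<open>B - A\<close> enter through the
  face opposite \<open>B\<close> and leave through the face opposite \<open>A\<close>.
\<close>

lemma tetrahedron_integral_gradient:
  fixes A B C D :: "real^3" and g :: "real^3 \<Rightarrow> real"
  assumes det: "triple (B - A) (C - A) (D - A) \<noteq> 0"
    and der: "\<And>r. r \<in> convex hull {A, B, C, D} \<Longrightarrow> GDERIV g r :> G r"
    and cont: "continuous_on (convex hull {A, B, C, D}) G"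
  shows "(B - A) \<bullet> (LINT r:convex hull {A, B, C, D}|lborel. G r) =
    \<bar>triple (B - A) (C - A) (D - A)\<bar> * (triangle_pullback B C D g - triangle_pullback A C D g)"
proof -
  let ?p = "\<lambda>z. A + fst z *\<^sub>R (B - A) + fst (snd z) *\<^sub>R (C - A) + snd (snd z) *\<^sub>R (D - A)"
  have inhull: "?p z \<in> convex hull {A, B, C, D}" if "z \<in> unit_tetrahedron" for z
  proof -
    obtain x y t where z: "z = (x, y, t)" by (cases z)
    have "?p z = (1 - x - y - t) *\<^sub>R A + x *\<^sub>R B + y *\<^sub>R C + t *\<^sub>R D"
      by (simp add: z algebra_simps)
    moreover have "\<dots> \<in> convex hull {A, B, C, D}"
    proof -
      have "A \<in> convex hull {A, B, C, D}" "B \<in> convex hull {A, B, C, D}"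
        "C \<in> convex hull {A, B, C, D}" "D \<in> convex hull {A, B, C, D}"
        by (auto intro: hull_inc)
      then have "(\<Sum>i<4. [1 - x - y - t, x, y, t] ! i *\<^sub>R [A, B, C, D] ! i) \<in> convex hull {A, B, C, D}"
        using that
        by (intro convex_sum) (auto simp: eval_nat_numeral lessThan_Suc less_Suc_eq z unit_tetrahedron_def
              unit_triangle_def)
      then show ?thesis
        by (simp add: eval_nat_numeral lessThan_Suc add_ac)
    qed
    ultimately show ?thesis by simp
  qed
  have gc: "continuous_on (convex hull {A, B, C, D}) g"
    using der by (intro continuous_at_imp_continuous_on) (auto intro: GDERIV_imp_isCont)
  have contp: "continuous_on unit_tetrahedron (\<lambda>z. G (?p z))"
    by (rule continuous_on_compose2[OF cont]) (auto intro!: continuous_intros inhull)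
  have int: "set_integrable lborel unit_tetrahedron (\<lambda>z. G (?p z))"
    unfolding set_integrable_def by (rule borel_integrable_compact[OF compact_unit_tetrahedron contp])
  have "(B - A) \<bullet> (LINT z:unit_tetrahedron|lborel. G (?p z)) = (LINT z:unit_tetrahedron|lborel. (B - A) \<bullet> G (?p z))"
    using int integral_inner_right[of "B - A" lborel "\<lambda>z. indicator unit_tetrahedron z *\<^sub>R G (?p z)"]
    by (simp add: set_lebesgue_integral_def set_integrable_def)
  also have "\<dots> = (LINT b:unit_triangle|lborel. g (?p (1 - fst b - snd b, b)) - g (?p (0, b)))"
    unfolding unit_tetrahedron_def
  proof (rule integral_partial_derivative_below_graph)
    show "compact {(x :: real, b). b \<in> unit_triangle \<and> 0 \<le> x \<and> x \<le> 1 - fst b - snd b}"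
      using compact_unit_tetrahedron by (simp only: unit_tetrahedron_def)
    show "continuous_on {(x, b). b \<in> unit_triangle \<and> 0 \<le> x \<and> x \<le> 1 - fst b - snd b} (\<lambda>z. (B - A) \<bullet> G (?p z))"
      using contp unfolding unit_tetrahedron_def by (intro continuous_intros)
    show "((\<lambda>x. g (?p (x, b))) has_real_derivative (B - A) \<bullet> G (?p (x, b))) (at x within {0..1 - fst b - snd b})"
      if "b \<in> unit_triangle" "0 \<le> x" "x \<le> 1 - fst b - snd b" for x b
    proof -
      have "GDERIV g (A + x *\<^sub>R (B - A) + (fst b *\<^sub>R (C - A) + snd b *\<^sub>R (D - A))) :> G (?p (x, b))"
        using der[OF inhull, of "(x, b)"] that by (simp add: unit_tetrahedron_def add.assoc)
      from affine_line_derivative[OF this] show ?thesis by (simp add: add.assoc)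
    qed
  qed (auto simp: unit_triangle_def)
  also have "\<dots> = (LINT b:unit_triangle|lborel. g (B + fst b *\<^sub>R (C - B) + snd b *\<^sub>R (D - B))
      - g (A + fst b *\<^sub>R (C - A) + snd b *\<^sub>R (D - A)))"
    by (simp add: algebra_simps)
  also have "\<dots> = triangle_pullback B C D g - triangle_pullback A C D g"
    unfolding triangle_pullback_def
    by (intro set_integral_diff integrable_triangle_pullback continuous_on_subset[OF gc] hull_mono) auto
  finally show ?thesis
    by (simp add: tetrahedron_integral_affine[OF det cont])
qed

section \<open>Nondegenerate tetrahedra and the theorem of Gauss\<close>

lemma content_tetrahedron:
  fixes A B C D :: "real^3"
  assumes "distinct [A, B, C, D]"
  shows "measure lborel (convex hull {A, B, C, D}) = \<bar>triple (B - A) (C - A) (D - A)\<bar> / 6"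
proof -
  define f :: "3 \<Rightarrow> real^3" where "f = (\<lambda>m. if m = 1 then B else if m = 2 then C else D)"
  have "f ` UNIV = f ` {1, 2, 3}"
    by (simp only: UNIV_3)
  also have "\<dots> = {B, C, D}"
    by (simp add: f_def insert_commute)
  also have "\<dots> = {A, B, C, D} - {A}"
    using assms by auto
  finally have "f ` UNIV = {A, B, C, D} - {A}" .
  moreover have "inj f"
    using assms by (auto simp: f_def inj_def forall_3)
  ultimately have bij: "bij_betw f UNIV ({A, B, C, D} - {A})"
    by (simp add: bij_betw_def)
  have "measure lborel (convex hull {A, B, C, D}) = \<bar>det (\<chi> i j. f j $ i - A $ i)\<bar> / fact CARD(3)"
    by (rule content_simplex[OF _ _ _ bij]) (use assms in auto)
  also have "det (\<chi> i j. f j $ i - A $ i) = triple (B - A) (C - A) (D - A)"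
    by (simp add: f_def det_3 cross3_simps)
  finally show ?thesis
    by (simp add: fact_numeral)
qed

lemma UNIV_4_eq_if_distinct:
  fixes i j k l :: 4
  assumes "distinct [i, j, k, l]"
  shows "UNIV = {i, j, k, l}"
  using assms by (intro card_subset_eq[symmetric]) auto

text \<open>
  An affinely independent set of four points in space spans a convex set with interior points, and
  a convex set with interior points is not negligible.
\<close>

lemma content_pos_if_nondegenerate:
  assumes "nondegenerate P"
  shows "measure lborel (tetrahedron P) > 0"
proof -
  have fin: "finite (range P)" and card: "card (range P) = 4"
    using assms by (auto simp: nondegenerate_def card_image)
  have "interior (tetrahedron P) \<noteq> {}"
    unfolding tetrahedron_def using assms card
    by (subst interior_convex_hull_eq_empty) (auto simp: nondegenerate_def)
  moreover have "compact (tetrahedron P)"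
    unfolding tetrahedron_def using fin by (rule finite_imp_compact_convex_hull)
  ultimately have "measure lebesgue (tetrahedron P) \<noteq> 0"
    using negligible_convex_interior[of "tetrahedron P"] negligible_iff_measure0[of "tetrahedron P"]
      lmeasurable_compact[of "tetrahedron P"]
    by (auto simp: tetrahedron_def)
  moreover have "tetrahedron P \<in> sets lborel"
    using \<open>compact (tetrahedron P)\<close> by (simp add: borel_compact)
  ultimately show ?thesis
    by (simp add: zero_less_measure_iff)
qed

lemma tetrahedron_by_distinct_vertices:
  assumes "nondegenerate P" "distinct [i, j, k, l]"
  shows "tetrahedron P = convex hull {P i, P j, P k, P l}" "distinct [P i, P j, P k, P l]"
    and "measure lborel (tetrahedron P) = \<bar>triple (P j - P i) (P k - P i) (P l - P i)\<bar> / 6"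
    and "triple (P j - P i) (P k - P i) (P l - P i) \<noteq> 0"
proof -
  show *: "tetrahedron P = convex hull {P i, P j, P k, P l}"
    unfolding tetrahedron_def UNIV_4_eq_if_distinct[OF assms(2)] by simp
  show **: "distinct [P i, P j, P k, P l]"
    using assms by (auto simp: nondegenerate_def inj_def)
  show "measure lborel (tetrahedron P) = \<bar>triple (P j - P i) (P k - P i) (P l - P i)\<bar> / 6"
    unfolding * using content_tetrahedron[OF **] by simp
  then show "triple (P j - P i) (P k - P i) (P l - P i) \<noteq> 0"
    using content_pos_if_nondegenerate[OF assms(1)] by auto
qed

text \<open>
  Tested against the edge \<open>P j - P i\<close>, the volume integral becomes a difference of two face integrals. On
  the right-hand side the two faces that contain this edge drop out, since their normals are orthogonal to it,
  and in the other two terms area times height is \<open>J\<close>, six times the volume, with opposite signs.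
  Agreement against the three edges from one vertex
  forces the two vectors to be equal.
\<close>

theorem tetrahedron_gauss:
  fixes g :: "real^3 \<Rightarrow> real"
  assumes tetra: "nondegenerate P"
    and faces: "\<And>i. range (p i) = P ` (UNIV - {i})"
    and normals: "\<And>i. outward_unit_normal P i (n i)"
    and der: "\<And>r. r \<in> tetrahedron P \<Longrightarrow> GDERIV g r :> G r"
    and cont: "continuous_on (tetrahedron P) G"
  shows "(LINT r:tetrahedron P|lborel. G r) = (\<Sum>i\<in>UNIV. triangle_integral (p i) g *\<^sub>R n i)"
    (is "?X = ?Y")
proof -
  have gc: "continuous_on (tetrahedron P) g"
    using der by (intro continuous_at_imp_continuous_on) (auto intro: GDERIV_imp_isCont)
  have face: "triangle_integral (p i) g =
      norm (cross3 (P k - P j) (P l - P j)) * triangle_pullback (P j) (P k) (P l) g"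
    if d: "distinct [i, j, k, l]" for i j k l
  proof -
    have "UNIV - {i} = {j, k, l}"
      using UNIV_4_eq_if_distinct[OF d] d by auto
    then have range: "range (p i) = {P j, P k, P l}"
      using faces[of i] by simp
    have "continuous_on (convex hull {P j, P k, P l}) g"
      unfolding tetrahedron_by_distinct_vertices(1)[OF tetra d]
      by (rule continuous_on_subset[OF gc[unfolded tetrahedron_by_distinct_vertices(1)[OF tetra d]]], rule hull_mono) auto
    from triangle_integral_eq_pullback[OF this range] show ?thesis
      using tetrahedron_by_distinct_vertices(2)[OF tetra d] by simp
  qed
  \<comment> \<open>The remaining indices \<open>k, l\<close> are those of the two faces that contain the edge.\<close>
  have eq: "(P j - P i) \<bullet> ?X = (P j - P i) \<bullet> ?Y" if d: "distinct [i, j, k, l]" for i j k l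
  proof -
    note hull = tetrahedron_by_distinct_vertices(1)[OF tetra d]
    define J where "J = \<bar>triple (P j - P i) (P k - P i) (P l - P i)\<bar>"
    have n: "norm (n m) = 1" "x \<noteq> m \<Longrightarrow> y \<noteq> m \<Longrightarrow> n m \<bullet> (P x - P y) = 0"
      "x \<noteq> m \<Longrightarrow> n m \<bullet> (P m - P x) < 0" for m x y
      using normals[of m] by (auto simp: outward_unit_normal_def)
    \<comment> \<open>The edge leaves the tetrahedron through face \<open>i\<close> and enters it through face \<open>j\<close>.\<close>
    have i: "triangle_integral (p i) g * (n i \<bullet> (P j - P i)) = J * triangle_pullback (P j) (P k) (P l) g"
    proof -
      have "n i \<bullet> (P j - P i) > 0"
        using n(3)[of j i] d by (auto simp: inner_diff_right)
      moreover have "\<bar>triple (P j - P i) (P k - P j) (P l - P j)\<bar> = J"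
        unfolding J_def by (rule arg_cong[where f = abs]) (simp add: cross3_simps)
      ultimately have "(n i \<bullet> (P j - P i)) * norm (cross3 (P k - P j) (P l - P j)) = J"
        using inner_unit_normal_mult_norm_cross[of "n i" "P k - P j" "P l - P j" "P j - P i"]
          n(1)[of i] n(2)[of k i j] n(2)[of l i j] d by auto
      then show ?thesis
        by (simp add: face[OF d] mult_ac)
    qed
    have j: "triangle_integral (p j) g * (n j \<bullet> (P j - P i)) = - J * triangle_pullback (P i) (P k) (P l) g"
    proof -
      have "n j \<bullet> (P j - P i) < 0"
        using n(3)[of i j] d by simp
      then have N: "(n j \<bullet> (P j - P i)) * norm (cross3 (P k - P i) (P l - P i)) = - J"
        using inner_unit_normal_mult_norm_cross[of "n j" "P k - P i" "P l - P i" "P j - P i"]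
          n(1)[of j] n(2)[of k j i] n(2)[of l j i] d by (auto simp: J_def)
      have "triangle_integral (p j) g =
          norm (cross3 (P k - P i) (P l - P i)) * triangle_pullback (P i) (P k) (P l) g"
        using d by (intro face) auto
      then have "triangle_integral (p j) g * (n j \<bullet> (P j - P i)) =
          (n j \<bullet> (P j - P i)) * norm (cross3 (P k - P i) (P l - P i)) * triangle_pullback (P i) (P k) (P l) g"
        by (simp only: mult_ac)
      then show ?thesis
        by (simp only: N)
    qed
    have "(P j - P i) \<bullet> ?X = J * (triangle_pullback (P j) (P k) (P l) g - triangle_pullback (P i) (P k) (P l) g)"
      unfolding hull J_def
      by (rule tetrahedron_integral_gradient[OF tetrahedron_by_distinct_vertices(4)[OF tetra d]])
         (use der cont hull in auto)
    moreover have "(P j - P i) \<bullet> ?Y = (\<Sum>m\<in>{i, j, k, l}. triangle_integral (p m) g * (n m \<bullet> (P j - P i)))"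
      unfolding UNIV_4_eq_if_distinct[OF d] inner_sum_right by (simp add: inner_commute)
    moreover have "\<dots> = J * triangle_pullback (P j) (P k) (P l) g - J * triangle_pullback (P i) (P k) (P l) g"
      using d i j n(2)[of j k i] n(2)[of j l i] by simp
    ultimately show ?thesis
      by (simp add: algebra_simps)
  qed
  have "distinct [4, 1, 2, 3 :: 4]" "distinct [4, 2, 3, 1 :: 4]" "distinct [4, 3, 1, 2 :: 4]"
    by auto
  from eq[OF this(1)] eq[OF this(2)] eq[OF this(3)] tetrahedron_by_distinct_vertices(4)[OF tetra this(1)]
  show ?thesis
    by (auto intro: eq_if_inner_eq_on_basis simp: inner_commute)
qed

section \<open>Antiderivatives along an edge\<close>

lemma DERIV_ln_add_sqrt:
  assumes "x\<^sup>2 + k > 0" "x + sqrt (x\<^sup>2 + k) > 0"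
  shows "((\<lambda>x. ln (x + sqrt (x\<^sup>2 + k))) has_real_derivative 1 / sqrt (x\<^sup>2 + k)) (at x)"
proof -
  have "sqrt (x\<^sup>2 + k) > 0" using assms by simp
  then show ?thesis
    using assms by (auto intro!: derivative_eq_intros simp: field_simps)
qed

text \<open>
  Positivity of the argument of the logarithm at the start of an edge propagates along the edge. Only the
  degenerate case \<open>k = 0\<close>, in which the source lies on the line of the edge, restricts the starting point.
\<close>

lemma add_sqrt_pos_mono:
  fixes x y k :: real
  assumes "x \<le> y" "k \<ge> 0" "x + sqrt (x\<^sup>2 + k) > 0"
  shows "y + sqrt (y\<^sup>2 + k) > 0"
proof (cases "y > 0")
  case True
  then show ?thesis using assms(2) by (simp add: add_pos_nonneg)
next
  case False
  have "k \<noteq> 0"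
  proof
    assume "k = 0"
    then show False using assms False by simp
  qed
  then have "sqrt (y\<^sup>2) < sqrt (y\<^sup>2 + k)"
    using assms(2) by (intro real_sqrt_less_mono) simp
  then show ?thesis by (simp add: abs_less_iff)
qed

text \<open>
  With \<open>D\<close> the denominator of the argument, the derivative is a fraction with the factor \<open>R D - w x\<^sup>2\<close> in its
  numerator and \<open>D\<^sup>2 + (t x)\<^sup>2\<close> in its denominator. Both contain the factor \<open>t\<^sup>2 + w\<^sup>2\<close>, which cancels and leaves the rational function of \<open>R\<close>.
\<close>

lemma DERIV_arctan_solid_angle:
  fixes t w x :: real
  assumes "w > 0"
  defines "R \<equiv> \<lambda>x. sqrt (x\<^sup>2 + t\<^sup>2 + w\<^sup>2)"
  shows "((\<lambda>x. arctan (t * x / (t\<^sup>2 + w\<^sup>2 + w * R x))) has_real_derivative t / (R x * (R x + w))) (at x)"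
proof -
  define D where "D = t\<^sup>2 + w\<^sup>2 + w * R x"
  have pos: "x\<^sup>2 + t\<^sup>2 + w\<^sup>2 > 0"
    using assms by (simp add: add_nonneg_pos)
  then have R: "R x > 0" "(R x)\<^sup>2 = x\<^sup>2 + t\<^sup>2 + w\<^sup>2"
    by (simp_all add: R_def)
  have k: "t\<^sup>2 + w\<^sup>2 > 0" using assms by (simp add: add_nonneg_pos)
  then have D: "D > 0" using assms R by (simp add: D_def add_pos_pos)
  have dR: "(R has_real_derivative x / R x) (at x)"
    unfolding R_def using pos by (auto intro!: derivative_eq_intros simp: field_simps)
  have q: "((\<lambda>x. t * x / (t\<^sup>2 + w\<^sup>2 + w * R x)) has_real_derivative (t * D - t * x * (w * (x / R x))) / (D * D)) (at x)"
    using D unfolding D_def by (auto intro!: derivative_eq_intros dR simp: field_simps)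
  have "((\<lambda>x. arctan (t * x / (t\<^sup>2 + w\<^sup>2 + w * R x))) has_real_derivative
      inverse (1 + (t * x / D)\<^sup>2) * ((t * D - t * x * (w * (x / R x))) / (D * D))) (at x)"
    using DERIV_chain2[OF DERIV_arctan q] by (simp add: D_def)
  moreover have "inverse (1 + (t * x / D)\<^sup>2) * ((t * D - t * x * (w * (x / R x))) / (D * D)) = t / (R x * (R x + w))"
  proof -
    have a: "D\<^sup>2 + (t * x)\<^sup>2 = (t\<^sup>2 + w\<^sup>2) * (R x + w)\<^sup>2"
      using R(2) unfolding D_def by algebra
    have b: "R x * D - w * x\<^sup>2 = (t\<^sup>2 + w\<^sup>2) * (R x + w)"
      using R(2) unfolding D_def by algebra
    have "inverse (1 + (t * x / D)\<^sup>2) * ((t * D - t * x * (w * (x / R x))) / (D * D))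
        = t * (R x * D - w * x\<^sup>2) / (R x * (D\<^sup>2 + (t * x)\<^sup>2))"
    proof -
      have "D\<^sup>2 + (t * x)\<^sup>2 > 0"
        using D by (simp add: add_pos_nonneg)
      then have "inverse (1 + (t * x / D)\<^sup>2) = D\<^sup>2 / (D\<^sup>2 + (t * x)\<^sup>2)"
        using D by (simp add: field_simps)
      moreover have "(t * D - t * x * (w * (x / R x))) / (D * D) = t * (R x * D - w * x\<^sup>2) / (R x * D\<^sup>2)"
        using D R(1) by (simp add: field_simps power2_eq_square)
      ultimately show ?thesis
        using D by simp
    qed
    also have "\<dots> = t / (R x * (R x + w))"
    proof -
      have "R x + w > 0" using R(1) assms(1) by simp
      then show ?thesis
        unfolding a b using k by (simp add: power2_eq_square)
    qed
    finally show ?thesis .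
  qed
  ultimately show ?thesis by simp
qed

text \<open>
  In the applications \<open>L\<close> is the length of the segment and \<open>a\<close> the coordinate of its starting point, so that the substitution
  \<open>x = a + \<tau> * L\<close> turns the unit parameter into arc length.
\<close>

lemma segment_pullback_antiderivative:
  assumes H: "\<And>\<tau>. 0 \<le> \<tau> \<Longrightarrow> \<tau> \<le> 1 \<Longrightarrow>
      (H has_real_derivative h (a + \<tau> * L)) (at (a + \<tau> * L))"
    and eq: "\<And>\<tau>. 0 \<le> \<tau> \<Longrightarrow> \<tau> \<le> 1 \<Longrightarrow> g (P + \<tau> *\<^sub>R (Q - P)) = h (a + \<tau> * L)"
    and cont: "continuous_on {0..1} (\<lambda>\<tau>. h (a + \<tau> * L))"
  shows "L * segment_pullback P Q g = H (a + L) - H a"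
proof -
  have "L * segment_pullback P Q g = (LINT \<tau>|lborel. L * (indicator {0..1} \<tau> * h (a + \<tau> * L)))"
    unfolding segment_pullback_def set_lebesgue_integral_def integral_mult_right_zero
    using eq by (intro arg_cong2[where f = "(*)"] Bochner_Integration.integral_cong) (auto simp: indicator_def)
  also have "\<dots> = (LINT \<tau>|lborel. indicator {0..1} \<tau> *\<^sub>R (h (a + \<tau> * L) * L))"
    by (simp add: mult_ac)
  also have "\<dots> = H (a + 1 * L) - H (a + 0 * L)"
  proof (rule integral_FTC_atLeastAtMost)
    show "((\<lambda>\<tau>. H (a + \<tau> * L)) has_vector_derivative h (a + \<tau> * L) * L) (at \<tau> within {0..1})"
      if "0 \<le> \<tau>" "\<tau> \<le> 1" for \<tau>
    proof -
      have "((\<lambda>\<tau>. a + \<tau> * L) has_real_derivative L) (at \<tau> within {0..1})"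
        by (auto intro!: derivative_eq_intros)
      from DERIV_chain2[OF H[OF that] this] show ?thesis
        by (simp add: has_real_derivative_iff_has_vector_derivative)
    qed
  qed (auto intro!: continuous_intros cont)
  finally show ?thesis by simp
qed

section \<open>The local frame of a triangle\<close>

lemma mod_3_simps: "(0 :: 3) = 3" "(4 :: 3) = 1"
proof -
  show *: "(0 :: 3) = 3"
    using exhaust_3[of 0] by auto
  have "(4 :: 3) = 3 + 1"
    by simp
  also have "\<dots> = 1"
    unfolding *[symmetric] by simp
  finally show "(4 :: 3) = 1" .
qed

lemma edge_simps:
  "edge p 1 = p 3 - p 2" "edge p 2 = p 1 - p 3" "edge p 3 = p 2 - p 1"
  by (simp_all add: edge_def mod_3_simps)

locale triangle_frame =
  fixes p :: "3 \<Rightarrow> real^3" and r0 :: "real^3"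
  assumes cross_nonzero: "cross3 (p 2 - p 1) (p 3 - p 1) \<noteq> 0"
    and source: "r0 \<notin> convex hull range p"
begin

lemma start_plus_edge: "p (l + 1) + edge p l = p (l - 1)"
  by (simp add: edge_def)

lemma edge_len_pos: "edge_len p l > 0"
proof -
  have "edge p l \<noteq> 0"
    using exhaust_3[of l] cross_nonzero by (auto simp: edge_simps)
  then show ?thesis by (simp add: edge_len_def)
qed

lemma edge_eq_scaled: "edge p l = edge_len p l *\<^sub>R s_hat p l"
  using edge_len_pos[of l] by (simp add: s_hat_def)

lemma norm_s_hat: "norm (s_hat p l) = 1"
  using edge_len_pos[of l] by (simp add: s_hat_def edge_len_def)

lemma w_hat_eq:
  "w_hat p = cross3 (p 2 - p 1) (p 3 - p 1) /\<^sub>R norm (cross3 (p 2 - p 1) (p 3 - p 1))"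
proof -
  define k where "k = inverse (edge_len p 1) * inverse (edge_len p 2)"
  have "k > 0"
    using edge_len_pos by (simp add: k_def)
  have "cross3 (s_hat p 1) (s_hat p 2) = k *\<^sub>R cross3 (edge p 1) (edge p 2)"
    by (simp add: s_hat_def k_def cross_mult_left cross_mult_right mult.commute)
  also have "cross3 (edge p 1) (edge p 2) = cross3 (p 2 - p 1) (p 3 - p 1)"
    by (simp add: edge_simps forall_3 cross3_simps)
  finally show ?thesis
    using \<open>k > 0\<close> by (simp add: w_hat_def)
qed

lemma norm_w_hat: "norm (w_hat p) = 1"
  using cross_nonzero by (simp add: w_hat_eq)

lemma edge_perp_w_hat: "edge p l \<bullet> w_hat p = 0"
  using exhaust_3[of l] by (auto simp: w_hat_eq edge_simps inner_diff_left) (simp_all add: cross3_simps)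

lemma s_hat_perp_w_hat: "s_hat p l \<bullet> w_hat p = 0"
  by (simp add: s_hat_def edge_perp_w_hat)

lemma height_const: "(p l - r0) \<bullet> w_hat p = w0 p r0"
proof -
  have "(p l - p 1) \<bullet> w_hat p = 0"
    using exhaust_3[of l] edge_perp_w_hat[of 2] edge_perp_w_hat[of 3]
    by (auto simp: edge_simps inner_diff_left)
  then show ?thesis
    by (simp add: w0_def inner_diff_left)
qed

lemma frame_orthonormal:
  "u_hat p \<bullet> u_hat p = 1" "v_hat p \<bullet> v_hat p = 1" "u_hat p \<bullet> v_hat p = 0" "v_hat p \<bullet> u_hat p = 0"
  "cross3 (u_hat p) (w_hat p) = - v_hat p" "cross3 (v_hat p) (w_hat p) = u_hat p"
proof -
  have u: "norm (u_hat p) = 1" "u_hat p \<bullet> w_hat p = 0"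
    by (simp_all add: u_hat_def norm_s_hat s_hat_perp_w_hat)
  then show uu: "u_hat p \<bullet> u_hat p = 1"
    by (simp add: dot_square_norm)
  show *: "cross3 (u_hat p) (w_hat p) = - v_hat p"
    unfolding v_hat_def by (rule cross_skew)
  have "cross3 (cross3 w u) w = (w \<bullet> w) *\<^sub>R u - (u \<bullet> w) *\<^sub>R w" for u w :: "real^3"
    by (simp add: forall_3 cross3_simps)
  then show vw: "cross3 (v_hat p) (w_hat p) = u_hat p"
    using u norm_w_hat by (simp add: v_hat_def dot_square_norm)
  show uv: "u_hat p \<bullet> v_hat p = 0" "v_hat p \<bullet> u_hat p = 0"
    by (simp_all add: v_hat_def dot_cross_self inner_commute)
  have "(norm (v_hat p))\<^sup>2 + (w_hat p \<bullet> u_hat p)\<^sup>2 = (norm (w_hat p) * norm (u_hat p))\<^sup>2"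
    unfolding v_hat_def by (rule norm_cross_dot)
  then show "v_hat p \<bullet> v_hat p = 1"
    using u norm_w_hat by (simp add: dot_square_norm inner_commute)
qed

lemma edges_in_frame:
  "edge p 3 = edge_len p 3 *\<^sub>R u_hat p"
  "edge p 2 = - u3 p *\<^sub>R u_hat p - v3 p *\<^sub>R v_hat p"
  "edge p 1 = (u3 p - edge_len p 3) *\<^sub>R u_hat p + v3 p *\<^sub>R v_hat p"
proof -
  show e3: "edge p 3 = edge_len p 3 *\<^sub>R u_hat p"
    unfolding u_hat_def by (rule edge_eq_scaled)
  show e2: "edge p 2 = - u3 p *\<^sub>R u_hat p - v3 p *\<^sub>R v_hat p"
    using orthonormal_expansion[of "u_hat p" "w_hat p" "edge p 2"] norm_w_hat
    by (simp add: u3_def v3_def frame_orthonormal edge_perp_w_hat u_hat_def[symmetric] norm_s_hat[of 3, folded u_hat_def]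
        s_hat_perp_w_hat[of 3, folded u_hat_def])
  have "edge p 1 = - edge p 2 - edge p 3"
    by (simp add: edge_simps)
  then show "edge p 1 = (u3 p - edge_len p 3) *\<^sub>R u_hat p + v3 p *\<^sub>R v_hat p"
    unfolding e2 e3 by (simp add: algebra_simps)
qed

lemma vertices_relative_to_source:
  "p 2 - r0 = edge_len p 3 *\<^sub>R u_hat p - (r0 - p 1)"
  "p 3 - r0 = u3 p *\<^sub>R u_hat p + v3 p *\<^sub>R v_hat p - (r0 - p 1)"
  "p 1 - r0 = - (r0 - p 1)"
  using edges_in_frame(1,2) by (simp_all add: edge_simps algebra_simps)

lemma edge_len_nonzero [simp]: "edge_len p l \<noteq> 0"
  using edge_len_pos[of l] by simp

text \<open>
  The explicit formulas of the definitions are multiplied by the length of the edge to clear their denominators; they are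
  then scalar products written out in the frame \<open>u_hat p, v_hat p\<close>. From here on only this geometric
  meaning is used: \<open>s_minus\<close> and \<open>s_plus\<close> are the tangential coordinates of the end points of the edge relative to the
  source, and \<open>t0\<close> is their common coordinate along the outward conormal.
\<close>

lemma edge_coordinates:
  "edge_len p l * s_minus p r0 l = (p (l + 1) - r0) \<bullet> edge p l"
  "edge_len p l * s_plus p r0 l = (p (l - 1) - r0) \<bullet> edge p l"
  "edge_len p l * t0 p r0 l = (p (l + 1) - r0) \<bullet> cross3 (edge p l) (w_hat p)"
proof -
  define d where "d = r0 - p 1"
  have d: "d \<bullet> u_hat p = u0 p r0" "d \<bullet> v_hat p = v0 p r0"
    by (simp_all add: d_def u0_def v0_def)
  note vertices = vertices_relative_to_source[folded d_def]
  note expand = inner_diff_left inner_diff_right inner_add_left inner_add_right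
    cross_add_left cross_mult_left Cross3.left_diff_distrib
  consider "l = 1" | "l = 2" | "l = 3"
    using exhaust_3[of l] by auto
  then show "edge_len p l * s_minus p r0 l = (p (l + 1) - r0) \<bullet> edge p l"
    "edge_len p l * s_plus p r0 l = (p (l - 1) - r0) \<bullet> edge p l"
    "edge_len p l * t0 p r0 l = (p (l + 1) - r0) \<bullet> cross3 (edge p l) (w_hat p)"
    by (cases; simp add: s_minus_def s_plus_def t0_def edges_in_frame vertices mod_3_simps; 
        simp add: expand frame_orthonormal d; simp add: algebra_simps)+
qed

lemma s_minus_eq: "s_minus p r0 l = (p (l + 1) - r0) \<bullet> s_hat p l"
  using edge_coordinates(1)[of l] by (simp add: s_hat_def field_simps)

lemma s_plus_eq: "s_plus p r0 l = s_minus p r0 l + edge_len p l"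
proof -
  have "edge_len p l * s_plus p r0 l = (p (l + 1) + edge p l - r0) \<bullet> edge p l"
    unfolding edge_coordinates(2) start_plus_edge ..
  also have "\<dots> = (p (l + 1) - r0) \<bullet> edge p l + edge p l \<bullet> edge p l"
    by (simp add: inner_diff_left inner_add_left)
  also have "\<dots> = edge_len p l * (s_minus p r0 l + edge_len p l)"
    unfolding edge_coordinates(1)[symmetric]
    by (simp add: edge_len_def dot_square_norm power2_eq_square distrib_left)
  finally show ?thesis by simp
qed

lemma t0_eq: "t0 p r0 l = (p (l + 1) - r0) \<bullet> m_hat p l"
  using edge_coordinates(3)[of l] by (simp add: m_hat_def s_hat_def cross_mult_left field_simps)

lemma cross_edge_w_hat: "cross3 (edge p l) (w_hat p) = edge_len p l *\<^sub>R m_hat p l"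
  by (subst edge_eq_scaled) (simp add: m_hat_def cross_mult_left)

text \<open>
  Along an edge only the tangential coordinate varies, so the distance to the source is the square root of a
  quadratic polynomial in one variable. This is what makes the line integrals elementary.
\<close>

lemma edge_point_coords:
  fixes l :: 3 and \<tau> :: real
  defines "x \<equiv> p (l + 1) + \<tau> *\<^sub>R (p (l - 1) - p (l + 1)) - r0"
  shows "x \<bullet> s_hat p l = s_minus p r0 l + \<tau> * edge_len p l"
    and "x \<bullet> m_hat p l = t0 p r0 l"
    and "norm x = sqrt ((s_minus p r0 l + \<tau> * edge_len p l)\<^sup>2 + (t0 p r0 l)\<^sup>2 + (w0 p r0)\<^sup>2)"
proof -
  have x: "x = (p (l + 1) - r0) + (\<tau> * edge_len p l) *\<^sub>R s_hat p l"
    unfolding x_def edge_def[symmetric] by (subst edge_eq_scaled) simp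
  have "s_hat p l \<bullet> s_hat p l = 1"
    using norm_s_hat[of l] by (simp add: dot_square_norm)
  then show s: "x \<bullet> s_hat p l = s_minus p r0 l + \<tau> * edge_len p l"
    unfolding x s_minus_eq by (simp add: inner_add_left)
  show t: "x \<bullet> m_hat p l = t0 p r0 l"
    unfolding x t0_eq by (simp add: inner_add_left m_hat_def dot_cross_self)
  have w: "x \<bullet> w_hat p = w0 p r0"
    unfolding x by (simp only: inner_add_left height_const) (simp add: s_hat_perp_w_hat)
  show "norm x = sqrt ((s_minus p r0 l + \<tau> * edge_len p l)\<^sup>2 + (t0 p r0 l)\<^sup>2 + (w0 p r0)\<^sup>2)"
    using orthonormal_norm[OF norm_s_hat[of l] norm_w_hat s_hat_perp_w_hat, of x]
    by (simp add: s t[unfolded m_hat_def] w)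
qed

lemma edge_points_avoid_source:
  assumes "0 \<le> \<tau>" "\<tau> \<le> 1"
  shows "p (l + 1) + \<tau> *\<^sub>R (p (l - 1) - p (l + 1)) - r0 \<noteq> 0"
proof -
  have "p (l + 1) + \<tau> *\<^sub>R (p (l - 1) - p (l + 1)) \<in> convex hull {p (l + 1), p (l - 1)}"
    using assms by (intro segment_point_in_hull) auto
  moreover have "convex hull {p (l + 1), p (l - 1)} \<subseteq> convex hull range p"
    by (rule hull_mono) auto
  ultimately show ?thesis
    using source by auto
qed

lemma f2_eq_integral:
  assumes "f2_defined p r0 l"
  shows "f2 p r0 l = edge_len p l * segment_pullback (p (l + 1)) (p (l - 1)) (\<lambda>r. 1 / norm (r - r0))"
proof -
  define k where "k = (t0 p r0 l)\<^sup>2 + (w0 p r0)\<^sup>2"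
  define a where "a = s_minus p r0 l"
  define L where "L = edge_len p l"
  have k: "k \<ge> 0" by (simp add: k_def)
  have L: "L > 0" unfolding L_def by (rule edge_len_pos)
  have R: "R_minus p r0 l = sqrt (a\<^sup>2 + k)" "R_plus p r0 l = sqrt ((a + L)\<^sup>2 + k)"
    by (simp_all add: R_minus_def R_plus_def s_plus_eq a_def L_def k_def add.assoc)
  have n: "norm (p (l + 1) + \<tau> *\<^sub>R (p (l - 1) - p (l + 1)) - r0) = sqrt ((a + \<tau> * L)\<^sup>2 + k)" for \<tau>
    unfolding edge_point_coords(3) by (simp add: a_def k_def L_def add.assoc)
  have pos: "(a + \<tau> * L)\<^sup>2 + k > 0" if "0 \<le> \<tau>" "\<tau> \<le> 1" for \<tau>
    using edge_points_avoid_source[OF that, of l] n[of \<tau>] k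
    by (metis real_sqrt_gt_0_iff zero_less_norm_iff)
  have a: "a + sqrt (a\<^sup>2 + k) > 0"
    using assms by (simp add: f2_defined_def R a_def[symmetric] add.commute)
  have pos': "a + \<tau> * L + sqrt ((a + \<tau> * L)\<^sup>2 + k) > 0" if "0 \<le> \<tau>" for \<tau>
    using that L by (intro add_sqrt_pos_mono[OF _ k a]) simp
  have "L * segment_pullback (p (l + 1)) (p (l - 1)) (\<lambda>r. 1 / norm (r - r0)) =
      ln ((a + L) + sqrt ((a + L)\<^sup>2 + k)) - ln (a + sqrt (a\<^sup>2 + k))"
  proof (rule segment_pullback_antiderivative)
    show "((\<lambda>x. ln (x + sqrt (x\<^sup>2 + k))) has_real_derivative 1 / sqrt ((a + \<tau> * L)\<^sup>2 + k)) (at (a + \<tau> * L))"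
      if "0 \<le> \<tau>" "\<tau> \<le> 1" for \<tau>
      using that by (intro DERIV_ln_add_sqrt pos pos')
    show "continuous_on {0..1} (\<lambda>\<tau>. 1 / sqrt ((a + \<tau> * L)\<^sup>2 + k))"
      using pos by (intro continuous_intros) (auto simp: less_imp_neq[symmetric])
  qed (simp add: n)
  also have "\<dots> = f2 p r0 l"
    using a pos'[of 1] by (simp add: f2_def R s_plus_eq a_def[symmetric] L_def[symmetric] ln_div add.commute)
  finally show ?thesis by (simp add: L_def)
qed

lemma beta_edge_eq_integral:
  assumes "w0 p r0 \<noteq> 0"
  shows "beta_edge p r0 l = segment_pullback (p (l + 1)) (p (l - 1))
    (\<lambda>r. (cross3 (edge p l) (w_hat p) \<bullet> (r - r0)) * (1 / (norm (r - r0) * (norm (r - r0) + \<bar>w0 p r0\<bar>))))"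
    (is "_ = segment_pullback _ _ ?g")
proof -
  define t where "t = t0 p r0 l"
  define w where "w = \<bar>w0 p r0\<bar>"
  define a where "a = s_minus p r0 l"
  define L where "L = edge_len p l"
  have w: "w > 0" using assms by (simp add: w_def)
  have L: "L > 0" unfolding L_def by (rule edge_len_pos)
  let ?R = "\<lambda>x. sqrt (x\<^sup>2 + t\<^sup>2 + w\<^sup>2)"
  have n: "norm (p (l + 1) + \<tau> *\<^sub>R (p (l - 1) - p (l + 1)) - r0) = ?R (a + \<tau> * L)" for \<tau>
    unfolding edge_point_coords(3) by (simp add: a_def w_def L_def t_def)
  have m: "cross3 (edge p l) (w_hat p) \<bullet> (p (l + 1) + \<tau> *\<^sub>R (p (l - 1) - p (l + 1)) - r0) = L * t" for \<tau>
    using edge_point_coords(2)[of l \<tau>] by (simp add: cross_edge_w_hat L_def t_def inner_commute)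
  have R: "?R x > 0" "?R x * (?R x + w) \<noteq> 0" for x
  proof -
    show *: "?R x > 0" using w by (simp add: add_nonneg_pos)
    have "?R x + w > 0" using * w by (rule add_pos_pos)
    with * show "?R x * (?R x + w) \<noteq> 0"
      by (simp only: mult_eq_0_iff de_Morgan_disj less_imp_neq[symmetric] not_False_eq_True simp_thms)
  qed
  have "L * segment_pullback (p (l + 1)) (p (l - 1)) (\<lambda>r. ?g r / L) =
      arctan (t * (a + L) / (t\<^sup>2 + w\<^sup>2 + w * ?R (a + L))) - arctan (t * a / (t\<^sup>2 + w\<^sup>2 + w * ?R a))"
  proof (rule segment_pullback_antiderivative)
    show "((\<lambda>x. arctan (t * x / (t\<^sup>2 + w\<^sup>2 + w * ?R x))) has_real_derivative
        t / (?R (a + \<tau> * L) * (?R (a + \<tau> * L) + w))) (at (a + \<tau> * L))" for \<tau>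
      by (rule DERIV_arctan_solid_angle[OF w])
    show "continuous_on {0..1} (\<lambda>\<tau>. t / (?R (a + \<tau> * L) * (?R (a + \<tau> * L) + w)))"
      using R(2) by (intro continuous_intros ballI)
    show "?g (p (l + 1) + \<tau> *\<^sub>R (p (l - 1) - p (l + 1))) / L = t / (?R (a + \<tau> * L) * (?R (a + \<tau> * L) + w))" for \<tau>
      using L by (simp only: m n w_def[symmetric]) simp
  qed
  also have "\<dots> = beta_edge p r0 l"
    by (simp add: beta_edge_def R_zero_def R_plus_def R_minus_def s_plus_eq
        a_def[symmetric] L_def[symmetric] t_def[symmetric] w_def)
  also have "segment_pullback (p (l + 1)) (p (l - 1)) (\<lambda>r. ?g r / L) = segment_pullback (p (l + 1)) (p (l - 1)) ?g / L"
    unfolding segment_pullback_def by (rule set_integral_divide_zero)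
  finally show ?thesis using L by simp
qed

end

section \<open>The solid angle of a triangle\<close>

context triangle_frame
begin

abbreviation "E1 \<equiv> p 2 - p 1"
abbreviation "E2 \<equiv> p 3 - p 1"
abbreviation "area2 \<equiv> norm (cross3 E1 E2)"

lemma range_vertices: "range p = {p 1, p 2, p 3}"
  by (simp only: UNIV_3 image_insert image_empty)

lemma hull_neq_source: "r \<in> convex hull {p 1, p 2, p 3} \<Longrightarrow> r \<noteq> r0"
  using source unfolding range_vertices by auto

lemma area2_pos: "area2 > 0"
  using cross_nonzero by simp

lemma cross_sides_eq: "cross3 E1 E2 = area2 *\<^sub>R w_hat p"
  using cross_nonzero by (simp add: w_hat_eq)

lemma cross_sides_inner: "cross3 E1 E2 \<bullet> y = area2 * (w_hat p \<bullet> y)"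
  using arg_cong[OF cross_sides_eq, of "\<lambda>v. v \<bullet> y"] by simp

lemma sides_perp_w_hat: "E1 \<bullet> w_hat p = 0" "E2 \<bullet> w_hat p = 0"
  using edge_perp_w_hat[of 3] edge_perp_w_hat[of 2] by (simp_all add: edge_simps inner_diff_left)

lemma triangle_pullback_gradients:
  assumes der: "\<And>r. r \<in> convex hull {p 1, p 2, p 3} \<Longrightarrow> GDERIV g r :> G r"
    and cont: "continuous_on (convex hull {p 1, p 2, p 3}) G"
  shows "triangle_pullback (p 1) (p 2) (p 3) (\<lambda>r. E1 \<bullet> G r) =
      segment_pullback (p 2) (p 3) g - segment_pullback (p 3) (p 1) g"
    and "triangle_pullback (p 1) (p 2) (p 3) (\<lambda>r. E2 \<bullet> G r) =
      segment_pullback (p 2) (p 3) g - segment_pullback (p 1) (p 2) g"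
proof -
  show "triangle_pullback (p 1) (p 2) (p 3) (\<lambda>r. E1 \<bullet> G r) =
      segment_pullback (p 2) (p 3) g - segment_pullback (p 3) (p 1) g"
    unfolding segment_pullback_commute[of "p 3" "p 1"]
    by (rule triangle_pullback_gradient) (auto intro!: der continuous_intros cont)
  have c: "continuous_on (convex hull {p 1, p 2, p 3}) (\<lambda>r. E2 \<bullet> G r)"
    by (intro continuous_intros cont)
  have *: "{p 1, p 3, p 2} = {p 1, p 2, p 3}"
    by auto
  show "triangle_pullback (p 1) (p 2) (p 3) (\<lambda>r. E2 \<bullet> G r) =
      segment_pullback (p 2) (p 3) g - segment_pullback (p 1) (p 2) g"
    unfolding segment_pullback_commute[of "p 2" "p 3"] triangle_pullback_swap_23[OF c]
    by (rule triangle_pullback_gradient) (auto simp only: * intro!: der c)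
qed

text \<open>
  Let \<open>x = r - r0\<close>. The part of the field \<open>x / (R (R + \<omega>))\<close> parallel to the plane is the surface gradient of
  \<open>ln (R + \<omega>)\<close>, and its surface divergence is \<open>\<omega> / R\<^sup>3\<close>. It comes from the radial ansatz: in the distance \<open>\<rho>\<close> from
  the foot of the perpendicular the field of divergence \<open>\<omega> / R\<^sup>3\<close> is \<open>(1 - \<omega> / R) / \<rho>\<^sup>2\<close> times the position vector, and
  \<open>\<rho>\<^sup>2 = (R - \<omega>) (R + \<omega>)\<close> removes the apparent singularity at \<open>\<rho> = 0\<close>. The vectors \<open>cross3 E2 w\<close> and \<open>cross3 w E1\<close> are,
  up to the factor \<open>area2\<close>, dual to \<open>E1\<close> and \<open>E2\<close> in the plane, so the left-hand side is \<open>area2\<close> times that divergence.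
\<close>

lemma tangential_divergence:
  assumes w: "w0 p r0 \<noteq> 0" and z: "z \<in> unit_triangle"
  defines "r \<equiv> p 1 + fst z *\<^sub>R E1 + snd z *\<^sub>R E2"
  defines "R \<equiv> norm (r - r0)" and "\<omega> \<equiv> \<bar>w0 p r0\<bar>"
  defines "\<psi> \<equiv> 1 / (R * (R + \<omega>))" and "\<psi>' \<equiv> - (2 * R + \<omega>) / (R * (R + \<omega>))\<^sup>2"
  shows "E1 \<bullet> (\<psi> *\<^sub>R cross3 E2 (w_hat p) + (cross3 E2 (w_hat p) \<bullet> (r - r0) * \<psi>' / R) *\<^sub>R (r - r0)) +
    E2 \<bullet> (\<psi> *\<^sub>R cross3 (w_hat p) E1 + (cross3 (w_hat p) E1 \<bullet> (r - r0) * \<psi>' / R) *\<^sub>R (r - r0)) =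
    area2 * (\<omega> / R ^ 3)"
proof -
  define x where "x = r - r0"
  define w where "w = w_hat p"
  have unit: "w \<bullet> w = 1"
    using norm_w_hat by (simp add: w_def dot_square_norm)
  have height: "w \<bullet> x = w0 p r0"
  proof -
    have "x = (p 1 - r0) + (fst z *\<^sub>R E1 + snd z *\<^sub>R E2)"
      by (simp add: x_def r_def)
    then show ?thesis
      using sides_perp_w_hat height_const[of 1] unfolding w_def by (simp only: inner_commute[of "w_hat p"] inner_add_left inner_scaleR_left)
  qed
  have R: "R > 0" and x2: "x \<bullet> x = R\<^sup>2"
  proof -
    have "r \<in> convex hull {p 1, p 2, p 3}"
      unfolding r_def using triangle_point_in_hull[of "fst z" "snd z"] z by simp
    then show "R > 0" using hull_neq_source by (auto simp: R_def)
    show "x \<bullet> x = R\<^sup>2" by (simp add: R_def x_def dot_square_norm)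
  qed
  have "\<omega> > 0" using w by (simp add: \<omega>_def)
  have \<omega>2: "\<omega>\<^sup>2 = (w \<bullet> x)\<^sup>2" by (simp add: \<omega>_def height)
  have c: "E1 \<bullet> cross3 E2 w + E2 \<bullet> cross3 w E1 = 2 * area2"
  proof -
    have "a \<bullet> cross3 b c + b \<bullet> cross3 c a = 2 * (cross3 a b \<bullet> c)" for a b c :: "real^3"
      by (simp add: cross3_simps)
    from this[of E1 E2 w] show ?thesis
      using cross_sides_inner[of w] unit by (simp add: w_def)
  qed
  have d: "(cross3 E2 w \<bullet> x) * (E1 \<bullet> x) + (cross3 w E1 \<bullet> x) * (E2 \<bullet> x) = area2 * (R\<^sup>2 - \<omega>\<^sup>2)"
  proof -
    have "(cross3 b c \<bullet> x) * (a \<bullet> x) + (cross3 c a \<bullet> x) * (b \<bullet> x) =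
        (cross3 a b \<bullet> c) * (x \<bullet> x) - (cross3 a b \<bullet> x) * (c \<bullet> x)" for a b c :: "real^3"
      by (simp add: cross3_simps)
    from this[where a = E1 and b = E2 and c = w] have "(cross3 E2 w \<bullet> x) * (E1 \<bullet> x) + (cross3 w E1 \<bullet> x) * (E2 \<bullet> x) =
        (cross3 E1 E2 \<bullet> w) * (x \<bullet> x) - (cross3 E1 E2 \<bullet> x) * (w \<bullet> x)" .
    also have "\<dots> = area2 * (R\<^sup>2 - \<omega>\<^sup>2)"
      using unit unfolding cross_sides_inner w_def[symmetric] x2 \<omega>2
      by (simp add: power2_eq_square right_diff_distrib)
    finally show ?thesis .
  qed
  have "E1 \<bullet> (\<psi> *\<^sub>R cross3 E2 w + (cross3 E2 w \<bullet> x * \<psi>' / R) *\<^sub>R x) +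
      E2 \<bullet> (\<psi> *\<^sub>R cross3 w E1 + (cross3 w E1 \<bullet> x * \<psi>' / R) *\<^sub>R x) =
      \<psi> * (E1 \<bullet> cross3 E2 w + E2 \<bullet> cross3 w E1) +
      \<psi>' / R * ((cross3 E2 w \<bullet> x) * (E1 \<bullet> x) + (cross3 w E1 \<bullet> x) * (E2 \<bullet> x))"
    unfolding inner_add_right inner_scaleR_right
    by (simp only: distrib_left distrib_right add_divide_distrib mult_ac add_ac times_divide_eq_right
        times_divide_eq_left)
  also have "\<dots> = area2 * (2 * \<psi> + \<psi>' / R * ((R - \<omega>) * (R + \<omega>)))"
    unfolding c d by (simp add: algebra_simps power2_eq_square)
  also have "2 * \<psi> + \<psi>' / R * ((R - \<omega>) * (R + \<omega>)) = \<omega> / R ^ 3"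
  proof -
    \<comment> \<open>Since \<open>R\<^sup>2 - \<omega>\<^sup>2 = (R - \<omega>) S\<close>, one factor \<open>S\<close> of the denominator of \<open>\<psi>'\<close> cancels.\<close>
    define S where "S = R + \<omega>"
    have "S > 0" using R \<open>\<omega> > 0\<close> by (simp add: S_def)
    then have "2 * \<psi> + \<psi>' / R * ((R - \<omega>) * S) = (2 * R\<^sup>2 - (2 * R + \<omega>) * (R - \<omega>)) / (R ^ 3 * S)"
      using R by (simp add: \<psi>_def \<psi>'_def S_def[symmetric] field_simps eval_nat_numeral)
    also have "2 * R\<^sup>2 - (2 * R + \<omega>) * (R - \<omega>) = \<omega> * S"
      by (simp add: S_def power2_eq_square algebra_simps)
    also have "\<omega> * S / (R ^ 3 * S) = \<omega> / R ^ 3"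
      using \<open>S > 0\<close> by simp
    finally show ?thesis by (simp add: S_def)
  qed
  finally show ?thesis
    by (simp only: x_def w_def)
qed

text \<open>
  By the gradient theorem the two partial derivatives of the previous lemma integrate to fluxes through the edges, where the
  contributions of the edge from \<open>p 2\<close> to \<open>p 3\<close> combine into the one with conormal \<open>cross3 (edge p 1) (w_hat p)\<close>.
  On each edge the flux density is the derivative of an arctangent.
\<close>

lemma solid_angle:
  assumes w: "w0 p r0 \<noteq> 0"
  shows "beta p r0 = area2 * triangle_pullback (p 1) (p 2) (p 3) (\<lambda>r. \<bar>w0 p r0\<bar> / norm (r - r0) ^ 3)"
proof -
  define \<omega> where "\<omega> = \<bar>w0 p r0\<bar>"
  have "\<omega> > 0" using w by (simp add: \<omega>_def)
  define \<psi> where "\<psi> s = 1 / (s * (s + \<omega>))" for s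
  define \<psi>' where "\<psi>' s = - (2 * s + \<omega>) / (s * (s + \<omega>))\<^sup>2" for s
  define g where "g c r = (c \<bullet> (r - r0)) * \<psi> (norm (r - r0))" for c r :: "real^3"
  define G where "G c r = \<psi> (norm (r - r0)) *\<^sub>R c + ((c \<bullet> (r - r0)) * \<psi>' (norm (r - r0)) / norm (r - r0)) *\<^sub>R (r - r0)"
    for c r :: "real^3"
  let ?H = "convex hull {p 1, p 2, p 3}"
  have nz: "s \<noteq> 0" "s + \<omega> \<noteq> 0" if "s > 0" for s
    using that \<open>\<omega> > 0\<close> by auto
  have der: "GDERIV (g c) r :> G c r" if "r \<in> ?H" for c r
    unfolding g_def G_def
  proof (rule GDERIV_linear_times_radial)
    show "r \<noteq> r0" using hull_neq_source[OF that] .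
    then have "norm (r - r0) > 0" by simp
    from nz[OF this] show "(\<psi> has_real_derivative \<psi>' (norm (r - r0))) (at (norm (r - r0)))"
      unfolding \<psi>_def \<psi>'_def
      by (auto intro!: derivative_eq_intros simp: power2_eq_square)
  qed
  have cont: "continuous_on ?H (G c)" for c
    unfolding G_def \<psi>_def \<psi>'_def
    by (intro continuous_intros ballI; use nz hull_neq_source in simp)
  let ?c1 = "cross3 E2 (w_hat p)" and ?c2 = "cross3 (w_hat p) E1"
  have "area2 * triangle_pullback (p 1) (p 2) (p 3) (\<lambda>r. \<omega> / norm (r - r0) ^ 3) =
      triangle_pullback (p 1) (p 2) (p 3) (\<lambda>r. area2 * (\<omega> / norm (r - r0) ^ 3))"
    unfolding triangle_pullback_def by (rule set_integral_mult_right[symmetric])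
  also have "\<dots> = triangle_pullback (p 1) (p 2) (p 3) (\<lambda>r. E1 \<bullet> G ?c1 r + E2 \<bullet> G ?c2 r)"
    using tangential_divergence[OF w]
    by (intro triangle_pullback_cong) (simp only: G_def \<psi>_def \<psi>'_def \<omega>_def)
  also have "\<dots> = triangle_pullback (p 1) (p 2) (p 3) (\<lambda>r. E1 \<bullet> G ?c1 r) +
      triangle_pullback (p 1) (p 2) (p 3) (\<lambda>r. E2 \<bullet> G ?c2 r)"
    unfolding triangle_pullback_def
    by (intro set_integral_add integrable_triangle_pullback continuous_intros cont)
  also have "\<dots> = (segment_pullback (p 2) (p 3) (g ?c1) + segment_pullback (p 2) (p 3) (g ?c2))
      - segment_pullback (p 3) (p 1) (g ?c1) - segment_pullback (p 1) (p 2) (g ?c2)"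
    using triangle_pullback_gradients(1)[of "g ?c1" "G ?c1", OF der cont]
      triangle_pullback_gradients(2)[of "g ?c2" "G ?c2", OF der cont] by simp
  also have "\<dots> = (\<Sum>l\<in>UNIV. segment_pullback (p (l + 1)) (p (l - 1)) (g (cross3 (edge p l) (w_hat p))))"
  proof -
    have gc: "continuous_on ?H (g c)" for c
      using der by (intro continuous_at_imp_continuous_on) (auto intro: GDERIV_imp_isCont)
    have "set_integrable lborel {0..1} (\<lambda>t. g c (p 2 + t *\<^sub>R (p 3 - p 2)))" for c
      by (intro integrable_segment_pullback continuous_on_subset[OF gc] hull_mono) auto
    then have "segment_pullback (p 2) (p 3) (g (?c1 + ?c2)) =
        segment_pullback (p 2) (p 3) (g ?c1) + segment_pullback (p 2) (p 3) (g ?c2)"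
      unfolding segment_pullback_def
      by (subst set_integral_add(2)[symmetric]) (simp_all add: g_def inner_add_left distrib_right)
    moreover have "segment_pullback A B (g (- c)) = - segment_pullback A B (g c)" for A B c
      by (simp add: segment_pullback_def g_def set_lebesgue_integral_def)
    moreover have "(\<Sum>l\<in>UNIV. segment_pullback (p (l + 1)) (p (l - 1)) (g (cross3 (edge p l) (w_hat p)))) =
        segment_pullback (p 2) (p 3) (g (?c1 + ?c2)) + segment_pullback (p 3) (p 1) (g (- ?c1)) +
        segment_pullback (p 1) (p 2) (g (- ?c2))"
    proof -
      have "cross3 (edge p 1) (w_hat p) = ?c1 + ?c2" "cross3 (edge p 2) (w_hat p) = - ?c1"
        "cross3 (edge p 3) (w_hat p) = - ?c2"
        by (simp_all add: edge_simps forall_3 cross3_simps)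
      then show ?thesis
        by (simp add: sum_3 mod_3_simps)
    qed
    ultimately show ?thesis
      by simp
  qed
  also have "\<dots> = beta p r0"
    unfolding beta_def
    by (rule sum.cong[OF refl], subst beta_edge_eq_integral[OF w]) (simp add: g_def[abs_def] \<psi>_def \<omega>_def)
  finally show ?thesis by (simp add: \<omega>_def)
qed

end

section \<open>The closed form of the face integrals\<close>

lemma continuous_on_grad_inverse_dist:
  assumes "r0 \<notin> S"
  shows "continuous_on S (\<lambda>r. - (1 / norm (r - r0) ^ 3) *\<^sub>R (r - r0))"
  using assms by (intro continuous_intros) auto

text \<open>
  The gradient on the left is a description operator, meaningful only where the derivative exists; the
  triangle avoids the source, so it can be replaced by the explicit formula.
\<close>

lemma triangle_integral_grad_inverse_dist:
  assumes "r0 \<notin> convex hull range p"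
  shows "triangle_integral p (grad (\<lambda>r. 1 / norm (r - r0))) =
    norm (cross3 (p 2 - p 1) (p 3 - p 1)) *\<^sub>R
      triangle_pullback (p 1) (p 2) (p 3) (\<lambda>r. - (1 / norm (r - r0) ^ 3) *\<^sub>R (r - r0))"
proof -
  have "triangle_pullback (p 1) (p 2) (p 3) (grad (\<lambda>r. 1 / norm (r - r0))) =
      triangle_pullback (p 1) (p 2) (p 3) (\<lambda>r. - (1 / norm (r - r0) ^ 3) *\<^sub>R (r - r0))"
  proof (rule triangle_pullback_cong)
    fix z assume "z \<in> unit_triangle"
    then have "p 1 + fst z *\<^sub>R (p 2 - p 1) + snd z *\<^sub>R (p 3 - p 1) \<in> convex hull range p"
      using triangle_point_in_hull[of "fst z" "snd z" "p 1" "p 2" "p 3"] by (simp add: UNIV_3)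
    then have "p 1 + fst z *\<^sub>R (p 2 - p 1) + snd z *\<^sub>R (p 3 - p 1) \<noteq> r0"
      using assms by blast
    from grad_eqI[OF GDERIV_inverse_dist[OF this]]
    show "grad (\<lambda>r. 1 / norm (r - r0)) (p 1 + fst z *\<^sub>R (p 2 - p 1) + snd z *\<^sub>R (p 3 - p 1)) =
      - (1 / norm (p 1 + fst z *\<^sub>R (p 2 - p 1) + snd z *\<^sub>R (p 3 - p 1) - r0) ^ 3) *\<^sub>R
        (p 1 + fst z *\<^sub>R (p 2 - p 1) + snd z *\<^sub>R (p 3 - p 1) - r0)" .
  qed
  then show ?thesis
    by (simp only: triangle_integral_def triangle_pullback_def unit_triangle_def)
qed

lemma triangle_integral_dipole_field:
  assumes "r0 \<notin> convex hull range p"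
  shows "triangle_integral p (dipole_field q r0) =
    - (q \<bullet> triangle_integral p (grad (\<lambda>r. 1 / norm (r - r0))))"
proof -
  let ?G = "\<lambda>r. - (1 / norm (r - r0) ^ 3) *\<^sub>R (r - r0)"
  have "continuous_on (convex hull {p 1, p 2, p 3}) ?G"
    using assms by (intro continuous_on_grad_inverse_dist) (simp add: UNIV_3)
  then have "q \<bullet> triangle_pullback (p 1) (p 2) (p 3) ?G = triangle_pullback (p 1) (p 2) (p 3) (\<lambda>r. q \<bullet> ?G r)"
    by (rule inner_triangle_pullback)
  also have "(\<lambda>r. q \<bullet> ?G r) = (\<lambda>r. - dipole_field q r0 r)"
    by (simp add: dipole_field_def fun_eq_iff)
  also have "triangle_pullback (p 1) (p 2) (p 3) \<dots> = - triangle_pullback (p 1) (p 2) (p 3) (dipole_field q r0)"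
    by (simp add: triangle_pullback_def set_lebesgue_integral_def)
  finally show ?thesis
    unfolding triangle_integral_grad_inverse_dist[OF assms]
    by (simp add: triangle_integral_def triangle_pullback_def unit_triangle_def)
qed

text \<open>
  Both sides are tested against the sides \<open>E1\<close>, \<open>E2\<close> and the normal. Against a side, the gradient theorem gives a
  difference of two edge integrals of \<open>1 / R\<close>, that is of logarithms, and the conormals on the right produce the same
  difference. Against the normal, the integrand is \<open>- w0 / R\<^sup>3\<close> and the integral is a solid angle; if \<open>w0 = 0\<close>, both sides vanish.
\<close>

lemma (in triangle_frame) triangle_integral_grad_closed_form:
  assumes "\<forall>l. f2_defined p r0 l"
  shows "triangle_integral p (grad (\<lambda>r. 1 / norm (r - r0))) =
    - ((sgn (w0 p r0) * beta p r0) *\<^sub>R w_hat p) + (\<Sum>l\<in>UNIV. f2 p r0 l *\<^sub>R m_hat p l)"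
    (is "_ = ?Y")
proof -
  define \<rho> where "\<rho> r = 1 / norm (r - r0)" for r
  define G where "G r = - (1 / norm (r - r0) ^ 3) *\<^sub>R (r - r0)" for r
  let ?H = "convex hull {p 1, p 2, p 3}"
  have der: "GDERIV \<rho> r :> G r" if "r \<in> ?H" for r
    unfolding \<rho>_def G_def by (rule GDERIV_inverse_dist[OF hull_neq_source[OF that]])
  have cont: "continuous_on ?H G"
    unfolding G_def using hull_neq_source by (intro continuous_on_grad_inverse_dist) blast
  let ?X = "area2 *\<^sub>R triangle_pullback (p 1) (p 2) (p 3) G"
  define L where "L l = segment_pullback (p (l + 1)) (p (l - 1)) \<rho>" for l
  have L: "L 1 = segment_pullback (p 2) (p 3) \<rho>" "L 2 = segment_pullback (p 3) (p 1) \<rho>"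
    "L 3 = segment_pullback (p 1) (p 2) \<rho>"
    by (simp_all add: L_def mod_3_simps)
  have "f2 p r0 l *\<^sub>R m_hat p l = L l *\<^sub>R cross3 (edge p l) (w_hat p)" for l
    using f2_eq_integral[of l] assms by (simp add: cross_edge_w_hat L_def \<rho>_def[abs_def] mult.commute)
  then have Y: "y \<bullet> ?Y = - (sgn (w0 p r0) * beta p r0) * (y \<bullet> w_hat p) +
      (L 1 * (cross3 y (edge p 1) \<bullet> w_hat p) + L 2 * (cross3 y (edge p 2) \<bullet> w_hat p)
        + L 3 * (cross3 y (edge p 3) \<bullet> w_hat p))" for y
  proof -
    have "y \<bullet> cross3 e w = cross3 y e \<bullet> w" for e w
      by (simp add: cross3_simps)
    with \<open>\<And>l. f2 p r0 l *\<^sub>R m_hat p l = L l *\<^sub>R cross3 (edge p l) (w_hat p)\<close> show ?thesis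
      by (simp add: sum_3 inner_add_right inner_diff_right)
  qed
  have cross: "cross3 E1 (edge p 1) = cross3 E1 E2" "cross3 E1 (edge p 2) = - cross3 E1 E2"
    "cross3 E1 (edge p 3) = 0" "cross3 E2 (edge p 1) = cross3 E1 E2" "cross3 E2 (edge p 2) = 0"
    "cross3 E2 (edge p 3) = - cross3 E1 E2"
    by (simp_all add: edge_simps forall_3 cross3_simps)
  have ww: "w_hat p \<bullet> w_hat p = 1"
    using norm_w_hat by (simp add: dot_square_norm)
  have "?X = ?Y"
  proof (rule eq_if_inner_eq_on_basis)
    have "triple E1 E2 (w_hat p) = cross3 E1 E2 \<bullet> w_hat p"
      by (simp add: cross3_simps)
    then show "triple E1 E2 (w_hat p) \<noteq> 0"
      using area2_pos by (simp add: cross_sides_inner ww)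
    have "E1 \<bullet> ?X = area2 * (L 1 - L 2)"
      by (simp only: inner_scaleR_right inner_triangle_pullback[OF cont] triangle_pullback_gradients(1)[OF der cont] L)
    moreover have "E1 \<bullet> ?Y = area2 * (L 1 - L 2)"
      unfolding Y cross inner_minus_left cross_sides_inner ww sides_perp_w_hat by (simp add: algebra_simps)
    ultimately show "?X \<bullet> E1 = ?Y \<bullet> E1"
      by (simp only: inner_commute[of _ E1])
    have "E2 \<bullet> ?X = area2 * (L 1 - L 3)"
      by (simp only: inner_scaleR_right inner_triangle_pullback[OF cont] triangle_pullback_gradients(2)[OF der cont] L)
    moreover have "E2 \<bullet> ?Y = area2 * (L 1 - L 3)"
      unfolding Y cross inner_minus_left cross_sides_inner ww sides_perp_w_hat by (simp add: algebra_simps)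
    ultimately show "?X \<bullet> E2 = ?Y \<bullet> E2"
      by (simp only: inner_commute[of _ E2])
    have perp: "cross3 (w_hat p) e \<bullet> w_hat p = 0" for e
      by (simp add: dot_cross_self)
    have "triangle_pullback (p 1) (p 2) (p 3) (\<lambda>r. w_hat p \<bullet> G r) =
        triangle_pullback (p 1) (p 2) (p 3) (\<lambda>r. - sgn (w0 p r0) * (\<bar>w0 p r0\<bar> / norm (r - r0) ^ 3))"
    proof (rule triangle_pullback_cong)
      fix z :: "real \<times> real"
      define r where "r = p 1 + fst z *\<^sub>R E1 + snd z *\<^sub>R E2"
      have "r - r0 = (p 1 - r0) + (fst z *\<^sub>R E1 + snd z *\<^sub>R E2)"
        by (simp add: r_def)
      then have "w_hat p \<bullet> (r - r0) = w0 p r0"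
        using sides_perp_w_hat height_const[of 1]
        by (simp only: inner_commute[of "w_hat p"] inner_add_left inner_scaleR_left)
      then have "w_hat p \<bullet> G r = - sgn (w0 p r0) * (\<bar>w0 p r0\<bar> / norm (r - r0) ^ 3)"
        by (simp add: G_def sgn_mult_abs)
      then show "w_hat p \<bullet> G (p 1 + fst z *\<^sub>R E1 + snd z *\<^sub>R E2) =
          - sgn (w0 p r0) * (\<bar>w0 p r0\<bar> / norm (p 1 + fst z *\<^sub>R E1 + snd z *\<^sub>R E2 - r0) ^ 3)"
        by (simp only: r_def)
    qed
    also have "\<dots> = - sgn (w0 p r0) * triangle_pullback (p 1) (p 2) (p 3) (\<lambda>r. \<bar>w0 p r0\<bar> / norm (r - r0) ^ 3)"
      unfolding triangle_pullback_def by (rule set_integral_mult_right)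
    finally have *: "triangle_pullback (p 1) (p 2) (p 3) (\<lambda>r. w_hat p \<bullet> G r) = \<dots>" .
    have "w_hat p \<bullet> ?X = - sgn (w0 p r0) * (area2 *
        triangle_pullback (p 1) (p 2) (p 3) (\<lambda>r. \<bar>w0 p r0\<bar> / norm (r - r0) ^ 3))"
      unfolding inner_scaleR_right inner_triangle_pullback[OF cont] * by (rule mult.left_commute)
    also have "\<dots> = - (sgn (w0 p r0) * beta p r0)"
    proof (cases "w0 p r0 = 0")
      case False
      show ?thesis
        unfolding solid_angle[OF False] by (rule mult_minus_left)
    qed simp
    finally have "w_hat p \<bullet> ?X = - (sgn (w0 p r0) * beta p r0)" .
    moreover have "w_hat p \<bullet> ?Y = - (sgn (w0 p r0) * beta p r0)"
      unfolding Y perp ww by simp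
    ultimately show "?X \<bullet> w_hat p = ?Y \<bullet> w_hat p"
      by (simp only: inner_commute[of _ "w_hat p"])
  qed
  then show ?thesis
    using triangle_integral_grad_inverse_dist[OF source] by (simp only: G_def[abs_def])
qed

section \<open>The volume element source vector\<close>

text \<open>
  A face spans a plane because the triple product of the whole tetrahedron, which does not vanish, has the
  cross product of two of its sides as a factor.
\<close>

lemma face_frame:
  fixes P :: "4 \<Rightarrow> real^3"
  assumes tetra: "nondegenerate P" and face: "range p = P ` (UNIV - {i})"
    and source: "r0 \<notin> tetrahedron P"
  shows "triangle_frame p r0"
proof
  \<comment> \<open>\<open>a\<close> lists the indices in the tetrahedron of the vertices of the face.\<close>
  have "\<exists>j. j \<noteq> i \<and> p m = P j" for m
  proof -
    have "p m \<in> P ` (UNIV - {i})"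
      unfolding face[symmetric] by simp
    then show ?thesis by blast
  qed
  then have "\<exists>a. \<forall>m. a m \<noteq> i \<and> p m = P (a m)"
    by (intro choice allI)
  then obtain a where a: "\<And>m. a m \<noteq> i" "\<And>m. p m = P (a m)"
    by blast
  have "P ` range a = P ` (UNIV - {i})"
    using face a(2) by auto
  then have "range a = UNIV - {i}"
    using tetra by (simp add: nondegenerate_def inj_image_eq_iff)
  then have "card (range a) = CARD(3)"
    by simp
  then have "inj a"
    by (simp add: eq_card_imp_inj_on)
  then have "distinct [i, a 1, a 2, a 3]"
    using a(1) a(1)[symmetric] by (simp add: inj_eq)
  from tetrahedron_by_distinct_vertices(4)[OF tetra this]
  have "triple (P (a 1) - P i) (P (a 2) - P i) (P (a 3) - P i) \<noteq> 0" .
  also have "triple (P (a 1) - P i) (P (a 2) - P i) (P (a 3) - P i) =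
      triple (P (a 1) - P i) (p 2 - p 1) (p 3 - p 1)"
    unfolding a(2) by (simp add: cross3_simps)
  finally show "cross3 (p 2 - p 1) (p 3 - p 1) \<noteq> 0"
    by auto
  have "convex hull range p \<subseteq> tetrahedron P"
    unfolding tetrahedron_def face by (rule hull_mono) auto
  then show "r0 \<notin> convex hull range p"
    using source by blast
qed

theorem mainTheorem2:
  fixes P :: "4 \<Rightarrow> real^3"              \<comment> \<open>vertices of the tetrahedron\<close>
    and p :: "4 \<Rightarrow> 3 \<Rightarrow> real^3"          \<comment> \<open>\<open>p i 1, p i 2, p i 3\<close>: vertices of face \<open>i\<close>, in any order\<close>
    and n :: "4 \<Rightarrow> real^3"
    and a b c d :: "real^4"
    and \<phi> :: "4 \<Rightarrow> real^3 \<Rightarrow> real"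
    and V \<sigma>inf :: real
    and \<sigma>c :: "real^3^3"
    and r0 q :: "real^3"
    and f :: "real^3 \<Rightarrow> real"
    and \<Lambda> :: "real^4^3"
  assumes tetra: "nondegenerate P"
    and vol: "V = measure lborel (tetrahedron P)"
    and faces: "\<And>i. range (p i) = P ` (UNIV - {i})"
    and normals: "\<And>i. outward_unit_normal P i (n i)"
    and source: "r0 \<notin> tetrahedron P"
    and f: "f = dipole_field q r0"
    and sigma_pos: "\<sigma>inf > 0"
    and affine: "\<And>i r. \<phi> i r = (a $ i + b $ i * r $ 1 + c $ i * r $ 2 + d $ i * r $ 3) / (6 * V)"
    and nodal: "\<And>i j. \<phi> i (P j) = (if i = j then 1 else 0)"
    and Lambda: "\<Lambda> = vector [b, c, d]"    \<comment> \<open>the rows are \<open>b, c, d\<close>\<close>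
  shows "volume_source_vector \<sigma>inf \<sigma>c f \<phi> (tetrahedron P) =
           (1 / (24 * pi * V * \<sigma>inf)) *\<^sub>R
             ((transpose \<Lambda> ** \<sigma>c) *v (\<Sum>i\<in>UNIV. triangle_integral (p i) f *\<^sub>R n i))
         \<and> (\<forall>i. triangle_integral (p i) f =
                - (q \<bullet> triangle_integral (p i) (grad (\<lambda>r. 1 / norm (r - r0)))))
         \<and> (\<forall>i. (\<forall>l. f2_defined (p i) r0 l) \<longrightarrow>
                triangle_integral (p i) f =
                - (q \<bullet> (- ((sgn (w0 (p i) r0) * beta (p i) r0) *\<^sub>R w_hat (p i))
                      + (\<Sum>l\<in>UNIV. f2 (p i) r0 l *\<^sub>R m_hat (p i) l))))"
proof (intro conjI allI impI)
  have frame: "triangle_frame (p i) r0" for i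
    using face_frame[OF tetra faces source] .
  show dipole: "triangle_integral (p i) f = - (q \<bullet> triangle_integral (p i) (grad (\<lambda>r. 1 / norm (r - r0))))" for i
    unfolding f by (rule triangle_integral_dipole_field[OF triangle_frame.source[OF frame]])
  show "triangle_integral (p i) f =
      - (q \<bullet> (- ((sgn (w0 (p i) r0) * beta (p i) r0) *\<^sub>R w_hat (p i)) + (\<Sum>l\<in>UNIV. f2 (p i) r0 l *\<^sub>R m_hat (p i) l)))"
    if "\<forall>l. f2_defined (p i) r0 l" for i
    unfolding dipole triangle_frame.triangle_integral_grad_closed_form[OF frame that] ..

  let ?T = "tetrahedron P"
  define G where "G r = (1 / norm (r - r0) ^ 3) *\<^sub>R q - (3 * (q \<bullet> (r - r0)) / norm (r - r0) ^ 5) *\<^sub>R (r - r0)" for r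
  define X where "X = (LINT r:?T|lborel. G r)"
  have ne: "r \<noteq> r0" if "r \<in> ?T" for r
    using that source by auto
  have der: "GDERIV f r :> G r" if "r \<in> ?T" for r
    unfolding f G_def by (rule GDERIV_dipole_field[OF ne[OF that]])
  have cont: "continuous_on ?T G"
    unfolding G_def using ne by (intro continuous_intros) auto
  have gauss: "X = (\<Sum>i\<in>UNIV. triangle_integral (p i) f *\<^sub>R n i)"
    unfolding X_def by (rule tetrahedron_gauss[OF tetra faces normals der cont])
  have "compact ?T"
    unfolding tetrahedron_def by (rule finite_imp_compact_convex_hull) simp
  then have int: "integrable lborel (\<lambda>r. indicator ?T r *\<^sub>R G r)"
    using cont by (rule borel_integrable_compact)
  have grad_\<phi>: "grad (\<phi> i) r = (1 / (6 * V)) *\<^sub>R vector [b $ i, c $ i, d $ i]" for i r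
  proof (rule grad_eqI)
    have "\<phi> i = (\<lambda>r. a $ i / (6 * V) + r \<bullet> ((1 / (6 * V)) *\<^sub>R vector [b $ i, c $ i, d $ i]))"
      by (simp add: fun_eq_iff affine inner_vec_def sum_3 add_divide_distrib mult.commute)
    then show "GDERIV (\<phi> i) r :> (1 / (6 * V)) *\<^sub>R vector [b $ i, c $ i, d $ i]"
      by (simp only: GDERIV_affine)
  qed
  have entry: "(LINT r:?T|lborel. (\<sigma>c *v grad f r) \<bullet> grad (\<phi> i) r) =
      1 / (6 * V) * ((transpose \<Lambda> ** \<sigma>c) *v X) $ i" for i
  proof -
    define e where "e = (1 / (6 * V)) *\<^sub>R (vector [b $ i, c $ i, d $ i] :: real^3)"
    have lin: "bounded_linear (\<lambda>x. (\<sigma>c *v x) \<bullet> e)"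
      by (rule bounded_linear_compose[OF bounded_linear_inner_left matrix_vector_mul_bounded_linear])
    have "(LINT r:?T|lborel. (\<sigma>c *v grad f r) \<bullet> grad (\<phi> i) r) =
        (LINT r|lborel. (\<sigma>c *v (indicator ?T r *\<^sub>R G r)) \<bullet> e)"
      unfolding set_lebesgue_integral_def
      by (intro Bochner_Integration.integral_cong)
         (auto simp: indicator_def grad_\<phi> e_def grad_eqI[OF der])
    also have "\<dots> = (\<sigma>c *v X) \<bullet> e"
      using integral_bounded_linear[OF lin int] by (simp add: X_def set_lebesgue_integral_def)
    also have "\<dots> = 1 / (6 * V) * (transpose \<Lambda> *v (\<sigma>c *v X)) $ i"
      by (simp add: e_def Lambda inner_vec_def sum_3 matrix_vector_mult_def transpose_def
          add_divide_distrib mult.commute)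
    finally show ?thesis
      by (simp add: matrix_vector_mul_assoc)
  qed
  show "volume_source_vector \<sigma>inf \<sigma>c f \<phi> ?T =
      (1 / (24 * pi * V * \<sigma>inf)) *\<^sub>R ((transpose \<Lambda> ** \<sigma>c) *v (\<Sum>i\<in>UNIV. triangle_integral (p i) f *\<^sub>R n i))"
    unfolding gauss[symmetric] by (simp add: volume_source_vector_def entry vec_eq_iff)
qed

end
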